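(* If $D$ is an acyclic digraph, then $$\frac{\partial\,\Xi_D}{\partial p_i}=\sum_H\Bigl(\sum_S\mu\bigl(\pi(S),V(H)\bigr)\Bigr)\,\Xi_{D\setminus H},$$ where $H$ runs over all (vertex-)induced subgraphs of $D$ with $i$ vertices, $S$ runs over all path covers of $H$, $\mu$ is the Möbius function of the lattice of partitions of $V(H)$, and $D\setminus H$ is the subgraph obtained by deleting $V(H)$ from $D$.
   Context: A digraph is a finite labelled directed graph without multiple edges, possibly with loops; acyclic means having no directed cycles (in particular no loops). A path-cycle cover of a digraph is a subset $S$ of its edges such that the spanning subgraph with edge set $S$ is a vertex-disjoint union of directed paths and directed cycles (isolated vertices are directed paths with no edges); a path cover is a path-cycle cover with no cycles. $\pi(S)$ and $\sigma(S)$ are the sets of vertex sets of the paths and cycles respectively. With $x,y$ two countably infinite sets of commuting indeterminates, $\tilde m_\lambda=(r_1!r_2!\cdots)m_\lambda$ ($r_i$ the number of parts of $\lambda$ equal to $i$), and set partitions in subscripts standing for the integer partition of their block sizes, $\Xi_D=\sum_S\tilde m_{\pi(S)}(x)\,p_{\sigma(S)}(y)$, the sum over all path-cycle covers $S$ of $D$; for acyclic $D$ it is a symmetric function in $x$ only. The derivative $\partial/\partial p_i$ ($i\ge1$) is taken by regarding $\Xi_D$ as a polynomial in the power sums $p_1,p_2,\dots$. Partitions of $V(H)$ are ordered by refinement, and $V(H)$ as an argument of $\mu$ denotes the one-block partition of $V(H)$. *)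

theory Defs
  imports
    "Graph_Theory.Digraph_Component"
    "HOL-Library.Multiset"
    "HOL-Library.Poly_Mapping"
    "HOL-Library.Disjoint_Sets"
begin

section \<open>Formal power series in arbitrarily many commuting indeterminates\<close>

text \<open>
  A monomial is the multiset of its indeterminates (each taken as often as its exponent says);
  a power series assigns a coefficient to every monomial.
\<close>

typedef ('v, 'a) mfps = "UNIV :: ('v multiset \<Rightarrow> 'a) set"
  morphisms mfps_coeff Abs_mfps by simp

setup_lifting type_definition_mfps

lemma finite_submultisets [simp]: "finite {A. A \<subseteq># (M :: 'v multiset)}"
proof (induction M)
  case (add x M)
  have "{A. A \<subseteq># add_mset x M} \<subseteq> {A. A \<subseteq># M} \<union> add_mset x ` {A. A \<subseteq># M}"
  proof
    fix A assume "A \<in> {A. A \<subseteq># add_mset x M}"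
    then have A: "A \<subseteq># add_mset x M" by simp
    show "A \<in> {A. A \<subseteq># M} \<union> add_mset x ` {A. A \<subseteq># M}"
    proof (cases "x \<in># A")
      case True
      then obtain B where B: "A = add_mset x B" by (meson multi_member_split)
      then show ?thesis using A by auto
    next
      case False
      then have "A \<subseteq># M" using A by (metis diff_single_trivial subset_eq_diff_conv
            add_mset_add_single)
      then show ?thesis by simp
    qed
  qed
  then show ?case using add.IH finite_subset by blast
qed simp

instantiation mfps :: (type, comm_ring_1) comm_ring_1
begin

lift_definition zero_mfps :: "('a, 'b) mfps" is "\<lambda>_. 0" .

lift_definition one_mfps :: "('a, 'b) mfps" is "\<lambda>M. if M = {#} then 1 else 0" .

lift_definition plus_mfps :: "('a, 'b) mfps \<Rightarrow> ('a, 'b) mfps \<Rightarrow> ('a, 'b) mfps"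
  is "\<lambda>f g M. f M + g M" .

lift_definition uminus_mfps :: "('a, 'b) mfps \<Rightarrow> ('a, 'b) mfps" is "\<lambda>f M. - f M" .

lift_definition minus_mfps :: "('a, 'b) mfps \<Rightarrow> ('a, 'b) mfps \<Rightarrow> ('a, 'b) mfps"
  is "\<lambda>f g M. f M - g M" .

lift_definition times_mfps :: "('a, 'b) mfps \<Rightarrow> ('a, 'b) mfps \<Rightarrow> ('a, 'b) mfps"
  is "\<lambda>f g M. \<Sum>A | A \<subseteq># M. f A * g (M - A)" .

instance
proof
  fix f g h :: "('a, 'b) mfps"
  show "f * g * h = f * (g * h)"
  proof transfer
    fix f g h :: "'a multiset \<Rightarrow> 'b"
    show "(\<lambda>M. \<Sum>A | A \<subseteq># M. (\<Sum>B | B \<subseteq># A. f B * g (A - B)) * h (M - A)) =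
          (\<lambda>M. \<Sum>A | A \<subseteq># M. f A * (\<Sum>B | B \<subseteq># M - A. g B * h (M - A - B)))"
    proof
      fix M :: "'a multiset"
      have *: "M - B - (A - B) = M - A" if "B \<subseteq># A" for A B :: "'a multiset"
        using that by (metis diff_diff_add_mset subset_mset.add_diff_inverse)
      have "(\<Sum>A | A \<subseteq># M. (\<Sum>B | B \<subseteq># A. f B * g (A - B)) * h (M - A)) =
            (\<Sum>(A, B) \<in> (SIGMA A:{A. A \<subseteq># M}. {B. B \<subseteq># A}). f B * g (A - B) * h (M - A))"
        by (subst sum.Sigma [symmetric]) (auto simp: sum_distrib_right)
      also have "\<dots> = (\<Sum>(A, B) \<in> (SIGMA A:{A. A \<subseteq># M}. {B. B \<subseteq># M - A}).
                        f A * (g B * h (M - A - B)))"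
        by (rule sum.reindex_bij_witness
              [where i = "\<lambda>(A, B). (A + B, A)" and j = "\<lambda>(A, B). (B, A - B)"])
           (auto simp: * mult.assoc subset_mset.le_diff_conv2 add.commute
               intro: subset_mset.order_trans)
      also have "\<dots> = (\<Sum>A | A \<subseteq># M. f A * (\<Sum>B | B \<subseteq># M - A. g B * h (M - A - B)))"
        by (subst sum.Sigma [symmetric]) (auto simp: sum_distrib_left)
      finally show "(\<Sum>A | A \<subseteq># M. (\<Sum>B | B \<subseteq># A. f B * g (A - B)) * h (M - A)) =
          (\<Sum>A | A \<subseteq># M. f A * (\<Sum>B | B \<subseteq># M - A. g B * h (M - A - B)))" .
    qed
  qed
  show "f * g = g * f"
  proof transfer
    fix f g :: "'a multiset \<Rightarrow> 'b"
    show "(\<lambda>M. \<Sum>A | A \<subseteq># M. f A * g (M - A)) = (\<lambda>M. \<Sum>A | A \<subseteq># M. g A * f (M - A))"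
    proof
      fix M :: "'a multiset"
      have *: "M - (M - A) = A" if "A \<subseteq># M" for A
        using that by (simp add: multiset_eq_iff subseteq_mset_def)
      show "(\<Sum>A | A \<subseteq># M. f A * g (M - A)) = (\<Sum>A | A \<subseteq># M. g A * f (M - A))"
        by (rule sum.reindex_bij_witness [where i = "\<lambda>A. M - A" and j = "\<lambda>A. M - A"])
           (auto simp: * mult.commute)
    qed
  qed
  show "1 * f = f"
  proof transfer
    fix f :: "'a multiset \<Rightarrow> 'b"
    have "(\<Sum>A | A \<subseteq># M. (if A = {#} then 1 else 0) * f (M - A)) = f M" for M
    proof -
      have "(\<Sum>A | A \<subseteq># M. (if A = {#} then 1 else 0) * f (M - A)) =
            (\<Sum>A\<in>{{#}}. (if A = {#} then 1 else 0) * f (M - A))"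
        by (rule sum.mono_neutral_right) auto
      then show ?thesis by simp
    qed
    then show "(\<lambda>M. \<Sum>A | A \<subseteq># M. (if A = {#} then 1 else 0) * f (M - A)) = f" by simp
  qed
  show "(f + g) * h = f * h + g * h"
    by transfer (simp add: distrib_right sum.distrib)
  show "(0 :: ('a, 'b) mfps) \<noteq> 1"
    by transfer (auto simp: fun_eq_iff)
qed (transfer; simp add: fun_eq_iff add.assoc add.commute)+

end

lift_definition mfps_const :: "'a :: zero \<Rightarrow> ('v, 'a) mfps"
  is "\<lambda>c M. if M = {#} then c else 0" .


section \<open>Symmetric functions in a set of indeterminates\<close>

datatype indet = X nat | Y nat

type_synonym symfun = "(indet, rat) mfps"

text \<open>
  The multiset of nonzero exponents of a monomial: for a partition \<open>\<alpha>\<close>, the monomial symmetric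
  function \<open>m\<^sub>\<alpha>\<close> is the sum of all monomials with exponents \<open>\<alpha>\<close>.
\<close>

definition exponents :: "'v multiset \<Rightarrow> nat multiset" where
  "exponents M = image_mset (count M) (mset_set (set_mset M))"

lift_definition monomial_sym :: "indet set \<Rightarrow> nat multiset \<Rightarrow> symfun"
  is "\<lambda>Z \<alpha> M. if set_mset M \<subseteq> Z \<and> exponents M = \<alpha> then 1 else 0" .

definition aug_monomial_sym :: "indet set \<Rightarrow> nat multiset \<Rightarrow> symfun" where
  "aug_monomial_sym Z \<alpha> = of_nat (\<Prod>i\<in>set_mset \<alpha>. fact (count \<alpha> i)) * monomial_sym Z \<alpha>"

text \<open>
  The \<open>k\<close>-th power sum of the indeterminates in \<open>Z\<close>, intended for \<open>k > 0\<close> only.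
\<close>

lift_definition power_sum :: "indet set \<Rightarrow> nat \<Rightarrow> symfun"
  is "\<lambda>Z k M. if \<exists>z\<in>Z. M = replicate_mset k z then 1 else 0" .

definition power_sum_part :: "indet set \<Rightarrow> nat multiset \<Rightarrow> symfun" where
  "power_sum_part Z \<alpha> = (\<Prod>k\<in>#\<alpha>. power_sum Z k)"


section \<open>Derivatives with respect to power sums\<close>

text \<open>
  Polynomials in \<open>p\<^sub>1, p\<^sub>2, \<dots>\<close> are finitely supported maps on monomials
  \<open>p\<^sub>\<alpha> = p\<^bsub>\<alpha>\<^sub>1\<^esub> p\<^bsub>\<alpha>\<^sub>2\<^esub> \<dots>\<close>, where \<open>\<alpha>\<close> is a partition, i.e. a multiset of positive integers.
\<close>

type_synonym ppoly = "nat multiset \<Rightarrow>\<^sub>0 rat"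

definition is_ppoly :: "ppoly \<Rightarrow> bool" where
  "is_ppoly P \<longleftrightarrow> (\<forall>\<alpha>\<in>Poly_Mapping.keys P. 0 \<notin># \<alpha>)"

definition ppoly_eval :: "ppoly \<Rightarrow> symfun" where
  "ppoly_eval P = (\<Sum>\<alpha>\<in>Poly_Mapping.keys P.
     mfps_const (Poly_Mapping.lookup P \<alpha>) * power_sum_part (range X) \<alpha>)"

definition ppoly_deriv :: "nat \<Rightarrow> ppoly \<Rightarrow> ppoly" where
  "ppoly_deriv i P = (\<Sum>\<alpha>\<in>Poly_Mapping.keys P.
     Poly_Mapping.single (\<alpha> - {#i#}) (of_nat (count \<alpha> i) * Poly_Mapping.lookup P \<alpha>))"

text \<open>
  The power sums are algebraically independent, so a symmetric function in the \<open>X\<close>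
  indeterminates is the value of exactly one polynomial in the power sums.
\<close>

definition p_deriv :: "nat \<Rightarrow> symfun \<Rightarrow> symfun" where
  "p_deriv i f = ppoly_eval (ppoly_deriv i (THE P. is_ppoly P \<and> ppoly_eval P = f))"


section \<open>Path-cycle covers\<close>

definition acyclic_digraph :: "('a, 'b) pre_digraph \<Rightarrow> bool" where
  "acyclic_digraph D \<longleftrightarrow> (\<nexists>p. pre_digraph.cycle D p)"

definition is_directed_path :: "('a, 'b) pre_digraph \<Rightarrow> bool" where
  "is_directed_path C \<longleftrightarrow> (\<exists>u p v. pre_digraph.apath C u p v \<and>
     arcs C = set p \<and> verts C = set (pre_digraph.awalk_verts C u p))"

definition is_directed_cycle :: "('a, 'b) pre_digraph \<Rightarrow> bool" where
  "is_directed_cycle C \<longleftrightarrow> (\<exists>p. pre_digraph.cycle C p \<and>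
     arcs C = set p \<and> verts C = tail C ` set p)"

text \<open>Connectedness of digraphs is that of the underlying undirected graph.\<close>

definition components :: "('a, 'b) pre_digraph \<Rightarrow> ('a, 'b) pre_digraph set" where
  "components D = {C. pre_digraph.max_subgraph D connected C}"

definition spanning_part :: "('a, 'b) pre_digraph \<Rightarrow> 'b set \<Rightarrow> ('a, 'b) pre_digraph" where
  "spanning_part D S = D\<lparr>arcs := S\<rparr>"

definition path_cycle_cover :: "('a, 'b) pre_digraph \<Rightarrow> 'b set \<Rightarrow> bool" where
  "path_cycle_cover D S \<longleftrightarrow> S \<subseteq> arcs D \<and>
     (\<forall>C\<in>components (spanning_part D S). is_directed_path C \<or> is_directed_cycle C)"

definition path_blocks :: "('a, 'b) pre_digraph \<Rightarrow> 'b set \<Rightarrow> 'a set set" where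
  "path_blocks D S = verts ` {C \<in> components (spanning_part D S). is_directed_path C}"

definition cycle_blocks :: "('a, 'b) pre_digraph \<Rightarrow> 'b set \<Rightarrow> 'a set set" where
  "cycle_blocks D S = verts ` {C \<in> components (spanning_part D S). is_directed_cycle C}"

definition path_cover :: "('a, 'b) pre_digraph \<Rightarrow> 'b set \<Rightarrow> bool" where
  "path_cover D S \<longleftrightarrow> path_cycle_cover D S \<and> cycle_blocks D S = {}"

definition block_sizes :: "'a set set \<Rightarrow> nat multiset" where
  "block_sizes \<pi> = image_mset card (mset_set \<pi>)"

text \<open>The series \<open>\<Xi>\<^sub>D\<close> in the two alphabets \<open>x\<close> and \<open>y\<close>.\<close>

definition path_cycle_symfun :: "('a, 'b) pre_digraph \<Rightarrow> symfun" where
  "path_cycle_symfun D = (\<Sum>S | path_cycle_cover D S.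
     aug_monomial_sym (range X) (block_sizes (path_blocks D S)) *
     power_sum_part (range Y) (block_sizes (cycle_blocks D S)))"

definition delete_verts :: "('a, 'b) pre_digraph \<Rightarrow> 'a set \<Rightarrow> ('a, 'b) pre_digraph" where
  "delete_verts D W = D \<restriction> (verts D - W)"


section \<open>The Moebius function of the partition lattice\<close>

lemma refines_card_less:
  assumes "finite V" "refines V \<rho> \<tau>" "\<rho> \<noteq> \<tau>"
  shows "card {\<sigma>. refines V \<sigma> \<rho>} < card {\<sigma>. refines V \<sigma> \<tau>}"
proof (rule psubset_card_mono)
  have "{\<sigma>. refines V \<sigma> \<tau>} \<subseteq> Pow (Pow V)"
    by (auto simp: refines_def partition_on_def)
  then show "finite {\<sigma>. refines V \<sigma> \<tau>}"
    using assms(1) by (meson finite_Pow_iff finite_subset)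
  have "refines V \<tau> \<tau>" using assms(2) by (auto simp: refines_def)
  moreover have "\<not> refines V \<tau> \<rho>" using assms refines_asym by blast
  ultimately show "{\<sigma>. refines V \<sigma> \<rho>} \<subset> {\<sigma>. refines V \<sigma> \<tau>}"
    using assms(2) refines_trans by blast
qed

function partition_moebius :: "'a set \<Rightarrow> 'a set set \<Rightarrow> 'a set set \<Rightarrow> int" where
  "partition_moebius V \<pi> \<tau> =
     (if finite V \<and> refines V \<pi> \<tau> then
        if \<pi> = \<tau> then 1
        else - (\<Sum>\<rho> | refines V \<pi> \<rho> \<and> refines V \<rho> \<tau> \<and> \<rho> \<noteq> \<tau>. partition_moebius V \<pi> \<rho>)
      else 0)"
  by pat_completeness auto
termination
  by (relation "measure (\<lambda>(V, \<pi>, \<tau>). card {\<sigma>. refines V \<sigma> \<tau>})") (auto intro: refines_card_less)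

declare partition_moebius.simps [simp del]

end

theory Submission
  imports Defs
begin

text \<open>
  For a set partition \<open>\<pi>\<close> of a finite set write \<open>p\<^sub>\<pi>\<close> for the product of the power sums of its block
  sizes. The coefficient of a monomial in \<open>p\<^sub>\<pi>\<close> counts the colourings of the points by
  indeterminates that are constant on the blocks of \<open>\<pi>\<close>; its coefficient in the augmented monomial
  symmetric function of \<open>\<pi>\<close> counts those whose colour classes are exactly the blocks. Sorting
  colourings by their colour classes writes \<open>p\<^sub>\<pi>\<close> as the sum of the augmented monomial functions of
  all coarser partitions, and Moebius inversion turns this around. As an acyclic digraph has no
  covers with cycles, \<open>\<Xi>\<^sub>D\<close> is the sum of \<open>\<mu>(\<pi>(S), \<sigma>) p\<^sub>\<sigma>\<close> over all path covers \<open>S\<close> and all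
  partitions \<open>\<sigma>\<close> coarser than \<open>\<pi>(S)\<close>
  (\<open>aug_monomial_sym_as_power_sums\<close>, \<open>path_cycle_symfun_as_power_sums\<close>).

  The derivative by \<open>p\<^sub>i\<close> removes from \<open>\<sigma>\<close> a block \<open>B\<close> of size \<open>i\<close>, in all possible ways. Fix \<open>B\<close>.
  No arc of \<open>S\<close> joins \<open>B\<close> to its complement, because \<open>B\<close> is a union of vertex sets of paths of \<open>S\<close>. So the pairs
  \<open>(S, \<sigma>)\<close> with \<open>B \<in> \<sigma>\<close> correspond to a path cover \<open>S1\<close> of the subgraph induced by \<open>B\<close>, together
  with a path cover \<open>S2\<close> of the rest and a partition of the rest coarser than \<open>\<pi>(S2)\<close>
  (\<open>coarsened_covers_with_block\<close>). The Moebius function is multiplicative along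
  this decomposition (\<open>partition_moebius_Un\<close>), hence the sum over these pairs is the product of the
  sum of \<open>\<mu>(\<pi>(S1), {B})\<close> and of the expansion of \<open>\<Xi>\<close> for \<open>D\<close> without \<open>B\<close>.

  The derivative of a series is taken through its unique expression in the power sums; uniqueness
  is their algebraic independence (\<open>ppoly_eval_inject\<close>).
\<close>

section \<open>Disjoint unions of set partitions\<close>

lemma partition_on_Un:
  assumes "partition_on A P" "partition_on B Q" "A \<inter> B = {}"
  shows "partition_on (A \<union> B) (P \<union> Q)"
proof (rule partition_onI)
  show "\<Union>(P \<union> Q) = A \<union> B"
    using assms by (auto simp: partition_on_def)
  show "{} \<notin> P \<union> Q"
    using assms by (auto simp: partition_on_def)
  fix X Y assume *: "X \<in> P \<union> Q" "Y \<in> P \<union> Q" "X \<noteq> Y"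
  have "X \<subseteq> A" if "X \<in> P" for X using that assms(1) by (auto simp: partition_on_def)
  moreover have "X \<subseteq> B" if "X \<in> Q" for X using that assms(2) by (auto simp: partition_on_def)
  moreover have "disjnt X Y" if "X \<in> P" "Y \<in> P"
    using that assms(1) *(3) by (auto simp: partition_on_def pairwise_def disjnt_def)
  moreover have "disjnt X Y" if "X \<in> Q" "Y \<in> Q"
    using that assms(2) *(3) by (auto simp: partition_on_def pairwise_def disjnt_def)
  ultimately show "disjnt X Y" using *(1,2) assms(3) unfolding disjnt_def by blast
qed

lemma blocks_within_Un:
  assumes "partition_on A P" "partition_on B Q" "A \<inter> B = {}"
  shows "{X \<in> P \<union> Q. X \<subseteq> A} = P"
proof -
  have "\<not> X \<subseteq> A" if "X \<in> Q" for X
  proof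
    assume "X \<subseteq> A"
    moreover have "X \<subseteq> B" "X \<noteq> {}" using that assms(2) by (auto simp: partition_on_def)
    ultimately show False using assms(3) by blast
  qed
  moreover have "X \<subseteq> A" if "X \<in> P" for X using that assms(1) by (auto simp: partition_on_def)
  ultimately show ?thesis by blast
qed

lemma partition_Un_eq_iff:
  assumes "partition_on A P" "partition_on B Q" "partition_on A P'" "partition_on B Q'"
    and "A \<inter> B = {}"
  shows "P \<union> Q = P' \<union> Q' \<longleftrightarrow> P = P' \<and> Q = Q'"
proof
  assume eq: "P \<union> Q = P' \<union> Q'"
  have "P = P'" using eq assms blocks_within_Un by metis
  moreover have "Q = Q'"
    using eq assms blocks_within_Un[of B Q A P] blocks_within_Un[of B Q' A P']
    by (metis Int_commute Un_commute)
  ultimately show "P = P' \<and> Q = Q'" by blast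
qed auto

lemma refines_partition:
  assumes "refines V P Q"
  shows "partition_on V P" "partition_on V Q"
  using assms by (simp_all add: refines_def)

lemma refines_block:
  assumes "refines V P Q" "B \<in> P"
  shows "\<exists>C\<in>Q. B \<subseteq> C"
  using assms by (simp add: refines_def)

lemma refines_Un:
  assumes "refines A P P'" "refines B Q Q'" "A \<inter> B = {}"
  shows "refines (A \<union> B) (P \<union> Q) (P' \<union> Q')"
proof -
  have "partition_on (A \<union> B) (P \<union> Q)" "partition_on (A \<union> B) (P' \<union> Q')"
    using assms partition_on_Un by (auto simp: refines_def)
  moreover have "\<forall>X\<in>P \<union> Q. \<exists>Y\<in>P' \<union> Q'. X \<subseteq> Y"
    using refines_block[OF assms(1)] refines_block[OF assms(2)] by blast
  ultimately show ?thesis by (simp only: refines_def)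
qed

text \<open>
  Below a partition that separates \<open>A\<close> from \<open>B\<close> no block meets both sets, so any partition in the
  interval falls apart into a partition of \<open>A\<close> and one of \<open>B\<close>. With \<open>refines_Un\<close> this identifies
  the interval with a product.
\<close>

lemma refines_UnD:
  assumes "refines (A \<union> B) (P \<union> Q) R" "refines (A \<union> B) R (P' \<union> Q')"
    and "partition_on A P" "partition_on B Q" "partition_on A P'" "partition_on B Q'"
    and "A \<inter> B = {}"
  shows "\<exists>R1 R2. R = R1 \<union> R2 \<and> refines A P R1 \<and> refines A R1 P' \<and> refines B Q R2 \<and> refines B R2 Q'"
proof -
  let ?R1 = "{X \<in> R. X \<subseteq> A}" and ?R2 = "{X \<in> R. X \<subseteq> B}"
  have R: "partition_on (A \<union> B) R" using assms(1) by (simp add: refines_def)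
  have P': "X \<subseteq> A" if "X \<in> P'" for X using that assms(5) by (auto simp: partition_on_def)
  have Q': "X \<subseteq> B" if "X \<in> Q'" for X using that assms(6) by (auto simp: partition_on_def)
  have sub: "X \<subseteq> A \<or> X \<subseteq> B" if X: "X \<in> R" for X
  proof -
    obtain Y where "Y \<in> P' \<union> Q'" "X \<subseteq> Y" using refines_block[OF assms(2), of X] X by blast
    then show ?thesis using P' Q' by blast
  qed
  have eq: "R = ?R1 \<union> ?R2" using sub by blast
  have ne: "X \<noteq> {}" if "X \<in> R" for X using R that by (auto simp: partition_on_def)
  have part: "partition_on A ?R1" "partition_on B ?R2"
  proof -
    have un: "\<Union>R = A \<union> B" using R by (simp add: partition_on_def)
    have "\<Union>?R1 = A"
    proof
      show "A \<subseteq> \<Union>?R1"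
      proof
        fix x assume "x \<in> A"
        then obtain X where "X \<in> R" "x \<in> X" using un by blast
        with sub[of X] \<open>x \<in> A\<close> assms(7) show "x \<in> \<Union>?R1" by blast
      qed
    qed auto
    moreover have "\<Union>?R2 = B"
    proof
      show "B \<subseteq> \<Union>?R2"
      proof
        fix x assume "x \<in> B"
        then obtain X where "X \<in> R" "x \<in> X" using un by blast
        with sub[of X] \<open>x \<in> B\<close> assms(7) show "x \<in> \<Union>?R2" by blast
      qed
    qed auto
    ultimately show "partition_on A ?R1" "partition_on B ?R2"
      using R unfolding partition_on_def disjoint_def by simp_all
  qed
  have "\<exists>Y\<in>?R1. X \<subseteq> Y" if X: "X \<in> P" for X
  proof -
    obtain Y where Y: "Y \<in> R" "X \<subseteq> Y" using refines_block[OF assms(1) UnI1[OF X]] by blast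
    moreover have "X \<noteq> {}" "X \<subseteq> A" using assms(3) X by (auto simp: partition_on_def)
    ultimately show ?thesis using sub[of Y] assms(7) by blast
  qed
  moreover have "\<exists>Y\<in>?R2. X \<subseteq> Y" if X: "X \<in> Q" for X
  proof -
    obtain Y where Y: "Y \<in> R" "X \<subseteq> Y" using refines_block[OF assms(1) UnI2[OF X]] by blast
    moreover have "X \<noteq> {}" "X \<subseteq> B" using assms(4) X by (auto simp: partition_on_def)
    ultimately show ?thesis using sub[of Y] assms(7) by blast
  qed
  moreover have "\<exists>Y\<in>P'. X \<subseteq> Y" if X: "X \<in> ?R1" for X
  proof -
    obtain Y where "Y \<in> P' \<union> Q'" "X \<subseteq> Y" using refines_block[OF assms(2), of X] X by blast
    then show ?thesis using Q'[of Y] X ne[of X] assms(7) by blast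
  qed
  moreover have "\<exists>Y\<in>Q'. X \<subseteq> Y" if X: "X \<in> ?R2" for X
  proof -
    obtain Y where "Y \<in> P' \<union> Q'" "X \<subseteq> Y" using refines_block[OF assms(2), of X] X by blast
    then show ?thesis using P'[of Y] X ne[of X] assms(7) by blast
  qed
  ultimately have "refines A P ?R1 \<and> refines A ?R1 P' \<and> refines B Q ?R2 \<and> refines B ?R2 Q'"
    using part assms(3-6) by (simp add: refines_def)
  then show ?thesis using eq by blast
qed

section \<open>The Moebius function of the partition lattice\<close>

lemma finite_refines_left: "finite V \<Longrightarrow> finite {\<rho>. refines V \<pi> \<rho>}"
  by (rule finite_subset[of _ "Pow (Pow V)"]) (auto simp: refines_def partition_on_def)

lemma partition_moebius_refl: "finite V \<Longrightarrow> partition_on V \<tau> \<Longrightarrow> partition_moebius V \<tau> \<tau> = 1"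
  by (subst partition_moebius.simps) (simp add: refines_refl)

lemma sum_partition_moebius_interval:
  assumes "finite V" "refines V \<pi> \<tau>"
  shows "(\<Sum>\<rho> | refines V \<pi> \<rho> \<and> refines V \<rho> \<tau>. partition_moebius V \<pi> \<rho>) = (if \<pi> = \<tau> then 1 else 0)"
proof -
  let ?I = "{\<rho>. refines V \<pi> \<rho> \<and> refines V \<rho> \<tau> \<and> \<rho> \<noteq> \<tau>}"
  have *: "{\<rho>. refines V \<pi> \<rho> \<and> refines V \<rho> \<tau>} = insert \<tau> ?I"
    using assms(2) refines_refl[OF refines_partition(2)[OF assms(2)]] by auto
  have fin: "finite ?I"
    by (rule finite_subset[OF _ finite_refines_left[OF assms(1), of \<pi>]]) auto
  show ?thesis
  proof (cases "\<pi> = \<tau>")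
    case True
    then have I: "?I = {}" using refines_asym by blast
    show ?thesis unfolding * I using True assms(1) refines_partition[OF assms(2)]
      by (simp add: partition_moebius_refl)
  next
    case False
    then show ?thesis unfolding * using assms fin
      by (simp add: partition_moebius.simps[of V \<pi> \<tau>])
  qed
qed

text \<open>
  The interval between two disjoint unions is the product of the two intervals. Both sides of the
  claim therefore have the same sum over that interval, and they agree below its top by
  induction, so they agree at the top.
\<close>

lemma partition_moebius_Un:
  assumes "finite A" "finite B" "A \<inter> B = {}" "refines A \<pi>1 \<tau>1" "refines B \<pi>2 \<tau>2"
  shows "partition_moebius (A \<union> B) (\<pi>1 \<union> \<pi>2) (\<tau>1 \<union> \<tau>2) =
    partition_moebius A \<pi>1 \<tau>1 * partition_moebius B \<pi>2 \<tau>2"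
  using assms(4,5)
proof (induction "card {\<sigma>. refines A \<sigma> \<tau>1} + card {\<sigma>. refines B \<sigma> \<tau>2}" arbitrary: \<tau>1 \<tau>2
    rule: less_induct)
  case less
  let ?I1 = "{\<rho>. refines A \<pi>1 \<rho> \<and> refines A \<rho> \<tau>1}"
  let ?I2 = "{\<rho>. refines B \<pi>2 \<rho> \<and> refines B \<rho> \<tau>2}"
  let ?I = "{\<rho>. refines (A \<union> B) (\<pi>1 \<union> \<pi>2) \<rho> \<and> refines (A \<union> B) \<rho> (\<tau>1 \<union> \<tau>2)}"
  let ?f = "\<lambda>(\<rho>1, \<rho>2). partition_moebius (A \<union> B) (\<pi>1 \<union> \<pi>2) (\<rho>1 \<union> \<rho>2)"
  let ?g = "\<lambda>(\<rho>1, \<rho>2). partition_moebius A \<pi>1 \<rho>1 * partition_moebius B \<pi>2 \<rho>2"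
  note parts = less.prems[unfolded refines_def]
  have inj: "inj_on (\<lambda>(\<rho>1, \<rho>2). \<rho>1 \<union> \<rho>2) (?I1 \<times> ?I2)"
    using partition_Un_eq_iff[OF _ _ _ _ assms(3)]
    by (auto simp: inj_on_def refines_def)
  have img: "?I = (\<lambda>(\<rho>1, \<rho>2). \<rho>1 \<union> \<rho>2) ` (?I1 \<times> ?I2)"
  proof
    show "?I \<subseteq> (\<lambda>(\<rho>1, \<rho>2). \<rho>1 \<union> \<rho>2) ` (?I1 \<times> ?I2)"
    proof
      fix R assume "R \<in> ?I"
      then obtain R1 R2 where "R = R1 \<union> R2" "R1 \<in> ?I1" "R2 \<in> ?I2"
        using refines_UnD[of A B \<pi>1 \<pi>2 R \<tau>1 \<tau>2] parts assms(3) by blast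
      then show "R \<in> (\<lambda>(\<rho>1, \<rho>2). \<rho>1 \<union> \<rho>2) ` (?I1 \<times> ?I2)" by force
    qed
  qed (auto intro!: refines_Un assms(3))
  have fin: "finite ?I1" "finite ?I2"
    using assms(1,2) by (auto intro: finite_subset[OF _ finite_refines_left])
  have top: "(\<tau>1, \<tau>2) \<in> ?I1 \<times> ?I2"
    using less.prems parts by (auto intro: refines_refl)
  have "sum ?f (?I1 \<times> ?I2) = (\<Sum>\<rho>\<in>?I. partition_moebius (A \<union> B) (\<pi>1 \<union> \<pi>2) \<rho>)"
    unfolding img by (subst sum.reindex[OF inj]) (simp add: case_prod_beta)
  also have "\<dots> = (if \<pi>1 \<union> \<pi>2 = \<tau>1 \<union> \<tau>2 then 1 else 0)"
    using assms(1,2) refines_Un[OF less.prems assms(3)]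
    by (intro sum_partition_moebius_interval) auto
  also have "\<dots> = (if \<pi>1 = \<tau>1 then 1 else 0) * (if \<pi>2 = \<tau>2 then 1 else 0)"
    using partition_Un_eq_iff[OF _ _ _ _ assms(3), of \<pi>1 \<pi>2 \<tau>1 \<tau>2] parts by auto
  also have "\<dots> = sum ?g (?I1 \<times> ?I2)"
    unfolding sum_partition_moebius_interval[OF assms(1) less.prems(1), symmetric]
      sum_partition_moebius_interval[OF assms(2) less.prems(2), symmetric]
    by (simp only: sum.cartesian_product sum_product)
  finally have eq: "sum ?f (?I1 \<times> ?I2) = sum ?g (?I1 \<times> ?I2)" .
  \<comment> \<open>Any other pair of the product is strictly below in at least one coordinate.\<close>
  have "sum ?f (?I1 \<times> ?I2 - {(\<tau>1, \<tau>2)}) = sum ?g (?I1 \<times> ?I2 - {(\<tau>1, \<tau>2)})"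
  proof (rule sum.cong[OF refl])
    fix p assume "p \<in> ?I1 \<times> ?I2 - {(\<tau>1, \<tau>2)}"
    then obtain \<rho>1 \<rho>2 where p: "p = (\<rho>1, \<rho>2)"
      and *: "refines A \<pi>1 \<rho>1" "refines A \<rho>1 \<tau>1" "refines B \<pi>2 \<rho>2" "refines B \<rho>2 \<tau>2"
      and ne: "\<not> (\<rho>1 = \<tau>1 \<and> \<rho>2 = \<tau>2)" by blast
    have "card {\<sigma>. refines A \<sigma> \<rho>1} < card {\<sigma>. refines A \<sigma> \<tau>1} \<or> \<rho>1 = \<tau>1"
      using refines_card_less[OF assms(1) *(2)] by blast
    moreover have "card {\<sigma>. refines B \<sigma> \<rho>2} < card {\<sigma>. refines B \<sigma> \<tau>2} \<or> \<rho>2 = \<tau>2"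
      using refines_card_less[OF assms(2) *(4)] by blast
    ultimately have "card {\<sigma>. refines A \<sigma> \<rho>1} + card {\<sigma>. refines B \<sigma> \<rho>2} <
        card {\<sigma>. refines A \<sigma> \<tau>1} + card {\<sigma>. refines B \<sigma> \<tau>2}"
      using ne by auto
    then show "?f p = ?g p"
      unfolding p using less.hyps[OF _ *(1,3)] by simp
  qed
  with eq have "?f (\<tau>1, \<tau>2) = ?g (\<tau>1, \<tau>2)"
    using sum.remove[OF _ top, of ?f] sum.remove[OF _ top, of ?g] fin by simp
  then show ?case by simp
qed

section \<open>Colourings that are constant on blocks\<close>

text \<open>
  Colourings are kept extensional, so that each of them is determined by its values on the
  partitioned set; the multiset \<open>M\<close> of colours used is the monomial that the colouring contributes.
\<close>

definition colourings :: "'v set \<Rightarrow> 'a set set \<Rightarrow> 'v multiset \<Rightarrow> ('a \<Rightarrow> 'v) set" where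
  "colourings Z \<pi> M = {c \<in> \<Union>\<pi> \<rightarrow>\<^sub>E Z. (\<forall>X\<in>\<pi>. \<forall>u\<in>X. \<forall>v\<in>X. c u = c v) \<and>
     image_mset c (mset_set (\<Union>\<pi>)) = M}"

definition proper_colourings :: "'v set \<Rightarrow> 'a set set \<Rightarrow> 'v multiset \<Rightarrow> ('a \<Rightarrow> 'v) set" where
  "proper_colourings Z \<pi> M =
     {c \<in> colourings Z \<pi> M. \<forall>u\<in>\<Union>\<pi>. \<forall>v\<in>\<Union>\<pi>. c u = c v \<longrightarrow> (\<exists>X\<in>\<pi>. u \<in> X \<and> v \<in> X)}"

lemma colouringsI:
  assumes "c \<in> \<Union>\<pi> \<rightarrow>\<^sub>E Z" "\<And>B u v. B \<in> \<pi> \<Longrightarrow> u \<in> B \<Longrightarrow> v \<in> B \<Longrightarrow> c u = c v"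
    and "image_mset c (mset_set (\<Union>\<pi>)) = M"
  shows "c \<in> colourings Z \<pi> M"
  unfolding colourings_def using assms by blast

lemma colouringsD:
  assumes "c \<in> colourings Z \<pi> M"
  shows "c \<in> \<Union>\<pi> \<rightarrow>\<^sub>E Z" "\<And>B u v. B \<in> \<pi> \<Longrightarrow> u \<in> B \<Longrightarrow> v \<in> B \<Longrightarrow> c u = c v"
    and "image_mset c (mset_set (\<Union>\<pi>)) = M"
  using assms unfolding colourings_def by blast+

lemma proper_colouringsI:
  assumes "c \<in> colourings Z \<pi> M"
    and "\<And>u v. u \<in> \<Union>\<pi> \<Longrightarrow> v \<in> \<Union>\<pi> \<Longrightarrow> c u = c v \<Longrightarrow> \<exists>B\<in>\<pi>. u \<in> B \<and> v \<in> B"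
  shows "c \<in> proper_colourings Z \<pi> M"
  unfolding proper_colourings_def using assms by blast

lemma proper_colouringsD:
  assumes "c \<in> proper_colourings Z \<pi> M"
  shows "c \<in> colourings Z \<pi> M"
    and "\<And>u v. u \<in> \<Union>\<pi> \<Longrightarrow> v \<in> \<Union>\<pi> \<Longrightarrow> c u = c v \<Longrightarrow> \<exists>B\<in>\<pi>. u \<in> B \<and> v \<in> B"
  using assms unfolding proper_colourings_def by blast+

lemma image_mset_const_mset_set:
  assumes "\<And>v. v \<in> B \<Longrightarrow> c v = z" "finite B"
  shows "image_mset c (mset_set B) = replicate_mset (card B) z"
proof -
  have "image_mset c (mset_set B) = image_mset (\<lambda>_. z) (mset_set B)"
    using assms by (intro image_mset_cong) simp
  then show ?thesis by (simp add: image_mset_const_eq)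
qed

lemma finite_colourings:
  assumes "finite (\<Union>\<pi>)"
  shows "finite (colourings Z \<pi> M)"
proof (rule finite_subset)
  show "colourings Z \<pi> M \<subseteq> \<Union>\<pi> \<rightarrow>\<^sub>E set_mset M"
  proof
    fix c assume c: "c \<in> colourings Z \<pi> M"
    have "set_mset M = c ` \<Union>\<pi>"
      using assms colouringsD(3)[OF c] by (metis finite_set_mset_mset_set set_image_mset)
    moreover have "c \<in> extensional (\<Union>\<pi>)"
      using colouringsD(1)[OF c] by (simp add: PiE_def)
    ultimately show "c \<in> \<Union>\<pi> \<rightarrow>\<^sub>E set_mset M"
      by (intro PiE_I) (auto simp: extensional_def)
  qed
  show "finite (\<Union>\<pi> \<rightarrow>\<^sub>E set_mset M)" using assms by (intro finite_PiE) auto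
qed

lemma finite_proper_colourings:
  "finite (\<Union>\<pi>) \<Longrightarrow> finite (proper_colourings Z \<pi> M)"
  unfolding proper_colourings_def by (intro finite_Collect_conjI disjI1) (simp add: finite_colourings)

text \<open>
  A colouring of one more block consists of the colour of the block and a colouring of the other
  blocks with what remains of the monomial. This is the recursion that multiplication by a power
  sum obeys.
\<close>

lemma colourings_insert:
  assumes "finite B" "finite (\<Union>\<pi>)" "B \<inter> \<Union>\<pi> = {}" "B \<noteq> {}"
  shows "bij_betw (\<lambda>(z, c) v. if v \<in> B then z else c v)
    (SIGMA z:{z\<in>Z. card B \<le> count M z}. colourings Z \<pi> (M - replicate_mset (card B) z))
    (colourings Z (insert B \<pi>) M)"
    (is "bij_betw ?F ?S ?T")
proof -
  obtain b where b: "b \<in> B" using assms(4) by blast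
  let ?U = "\<Union>\<pi>"
  have disj: "mset_set (B \<union> ?U) = mset_set B + mset_set ?U"
    using assms by (intro mset_set_Union) auto
  let ?G = "\<lambda>c. (c b, restrict c ?U)"
  show ?thesis
  proof (rule bij_betw_byWitness[where f' = ?G])
    show "\<forall>p\<in>?S. ?G (?F p) = p"
    proof
      fix p assume "p \<in> ?S"
      then obtain z c where p: "p = (z, c)"
        and *: "c \<in> colourings Z \<pi> (M - replicate_mset (card B) z)" by blast
      note c = colouringsD(1)[OF *]
      have "restrict (\<lambda>v. if v \<in> B then z else c v) ?U = c"
      proof
        fix v show "restrict (\<lambda>v. if v \<in> B then z else c v) ?U v = c v"
          using c assms(3) by (cases "v \<in> ?U") (auto simp: PiE_def extensional_def)
      qed
      then show "?G (?F p) = p" using b p by simp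
    qed
    show "\<forall>c\<in>?T. ?F (?G c) = c"
    proof
      fix c assume "c \<in> ?T"
      note c = colouringsD[OF this]
      show "?F (?G c) = c"
      proof
        fix v
        consider "v \<in> B" | "v \<notin> B" "v \<in> ?U" | "v \<notin> \<Union>(insert B \<pi>)" by blast
        then show "?F (?G c) v = c v"
        proof cases
          case 1
          then show ?thesis using c(2)[of B b v] b by simp
        next
          case 2
          then show ?thesis by simp
        next
          case 3
          then have "c v = undefined" using PiE_arb[OF c(1)] by blast
          moreover have "v \<notin> B" "v \<notin> ?U" using 3 by blast+
          ultimately show ?thesis by simp
        qed
      qed
    qed
    show "?F ` ?S \<subseteq> ?T"
    proof (rule image_subsetI)
      fix p assume "p \<in> ?S"
      then obtain z c where p: "p = (z, c)" and z: "z \<in> Z" "card B \<le> count M z"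
        and *: "c \<in> colourings Z \<pi> (M - replicate_mset (card B) z)" by blast
      note c = colouringsD[OF *]
      let ?c = "\<lambda>v. if v \<in> B then z else c v"
      have "?c \<in> colourings Z (insert B \<pi>) M"
      proof (rule colouringsI)
        have "image_mset ?c (mset_set (B \<union> ?U)) =
            image_mset ?c (mset_set B) + image_mset ?c (mset_set ?U)"
          using disj by simp
        also have "image_mset ?c (mset_set ?U) = image_mset c (mset_set ?U)"
          using assms(2,3) by (intro image_mset_cong) auto
        also have "image_mset ?c (mset_set B) = replicate_mset (card B) z"
          using assms(1) by (intro image_mset_const_mset_set) auto
        also have "replicate_mset (card B) z + image_mset c (mset_set ?U) = M"
          using c(3) z(2) by (simp add: count_le_replicate_mset_subset_eq)
        finally show "image_mset ?c (mset_set (\<Union>(insert B \<pi>))) = M" by simp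
        show "?c \<in> \<Union>(insert B \<pi>) \<rightarrow>\<^sub>E Z"
        proof (rule PiE_I)
          fix v assume "v \<in> \<Union>(insert B \<pi>)"
          then show "?c v \<in> Z" using PiE_mem[OF c(1)] z(1) by auto
        next
          fix v assume "v \<notin> \<Union>(insert B \<pi>)"
          then have "v \<notin> B" "v \<notin> ?U" by blast+
          then show "?c v = undefined" using PiE_arb[OF c(1)] by simp
        qed
        fix C u v assume C: "C \<in> insert B \<pi>" "u \<in> C" "v \<in> C"
        show "?c u = ?c v"
        proof (cases "C = B")
          case False
          then have "C \<in> \<pi>" using C by simp
          moreover have "u \<notin> B" "v \<notin> B" using C assms(3) \<open>C \<in> \<pi>\<close> by auto
          ultimately show ?thesis using c(2)[of C u v] C by simp
        qed (use C in simp)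
      qed
      then show "?F p \<in> ?T" using p by simp
    qed
    show "?G ` ?T \<subseteq> ?S"
    proof (rule image_subsetI)
      fix c assume "c \<in> ?T"
      note c = colouringsD[OF this]
      have "c v = c b" if "v \<in> B" for v using c(2)[of B v b] b that by blast
      then have "image_mset c (mset_set B) = replicate_mset (card B) (c b)"
        using assms(1) by (intro image_mset_const_mset_set) auto
      then have M: "M = replicate_mset (card B) (c b) + image_mset c (mset_set ?U)"
        using c(3) disj by simp
      have "restrict c ?U \<in> colourings Z \<pi> (M - replicate_mset (card B) (c b))"
      proof (rule colouringsI)
        have "image_mset (restrict c ?U) (mset_set ?U) = image_mset c (mset_set ?U)"
          using assms(2) by (intro image_mset_cong) auto
        then show "image_mset (restrict c ?U) (mset_set ?U) = M - replicate_mset (card B) (c b)"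
          using M by simp
        show "restrict c ?U \<in> ?U \<rightarrow>\<^sub>E Z" using PiE_mem[OF c(1)] by auto
        fix C u v assume C: "C \<in> \<pi>" "u \<in> C" "v \<in> C"
        then have "u \<in> ?U" "v \<in> ?U" by blast+
        then show "restrict c ?U u = restrict c ?U v" using c(2)[of C u v] C by simp
      qed
      moreover have "c b \<in> Z" using PiE_mem[OF c(1)] b by blast
      moreover have "card B \<le> count M (c b)" using M by simp
      ultimately show "?G c \<in> ?S" by blast
    qed
  qed
qed

lemma image_bij_betw_restrict:
  assumes "bij_betw f A B" "A' \<subseteq> A" "\<And>x. x \<in> A \<Longrightarrow> x \<in> A' \<longleftrightarrow> f x \<in> B'" "B' \<subseteq> B"
  shows "bij_betw f A' B'"
proof -
  have "f ` A' = B'"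
  proof
    show "f ` A' \<subseteq> B'" using assms(2,3) by blast
    show "B' \<subseteq> f ` A'"
    proof
      fix y assume "y \<in> B'"
      moreover from this obtain x where "x \<in> A" "y = f x"
        using assms(1,4) unfolding bij_betw_def by blast
      ultimately show "y \<in> f ` A'" using assms(3) by blast
    qed
  qed
  then show ?thesis using bij_betw_subset[OF assms(1,2)] by blast
qed

text \<open>
  The same correspondence, restricted. The colour \<open>z\<close> of the new block is absent from the other
  blocks exactly if the block uses up all occurrences of \<open>z\<close> in the monomial, which is why the
  bound on the multiplicity becomes an equality.
\<close>

lemma proper_colourings_insert:
  assumes "finite B" "finite (\<Union>\<pi>)" "B \<inter> \<Union>\<pi> = {}" "B \<noteq> {}"
  shows "bij_betw (\<lambda>(z, c) v. if v \<in> B then z else c v)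
    (SIGMA z:{z\<in>Z. count M z = card B}. proper_colourings Z \<pi> (M - replicate_mset (card B) z))
    (proper_colourings Z (insert B \<pi>) M)"
    (is "bij_betw ?F ?S ?T")
proof (rule image_bij_betw_restrict[OF colourings_insert[OF assms, of Z M]])
  let ?U = "\<Union>\<pi>"
  show "?S \<subseteq> (SIGMA z:{z\<in>Z. card B \<le> count M z}. colourings Z \<pi> (M - replicate_mset (card B) z))"
    by (auto simp: proper_colourings_def)
  show "?T \<subseteq> colourings Z (insert B \<pi>) M" by (auto simp: proper_colourings_def)
  fix p assume "p \<in> (SIGMA z:{z\<in>Z. card B \<le> count M z}. colourings Z \<pi> (M - replicate_mset (card B) z))"
  then obtain z c where p: "p = (z, c)" and z: "z \<in> Z" "card B \<le> count M z"
    and c: "c \<in> colourings Z \<pi> (M - replicate_mset (card B) z)" by auto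
  let ?c = "\<lambda>v. if v \<in> B then z else c v"
  obtain b where b: "b \<in> B" using assms(4) by blast
  have F: "?c \<in> colourings Z (insert B \<pi>) M"
    using bij_betwE[OF colourings_insert[OF assms, of Z M]] z c by auto
  have count: "count M z = card B \<longleftrightarrow> (\<forall>v\<in>?U. c v \<noteq> z)"
  proof -
    have "image_mset c (mset_set ?U) = M - replicate_mset (card B) z"
      by (rule colouringsD(3)[OF c])
    then have "(\<forall>v\<in>?U. c v \<noteq> z) \<longleftrightarrow> z \<notin># M - replicate_mset (card B) z"
      using assms(2) by (metis (no_types, lifting) finite_set_mset_mset_set imageE imageI set_image_mset)
    also have "\<dots> \<longleftrightarrow> count (M - replicate_mset (card B) z) z = 0"
      by (simp add: not_in_iff)
    finally show ?thesis using z(2) by auto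
  qed
  have out: "v \<notin> B" if "v \<in> ?U" for v using that assms(3) by blast
  show "p \<in> ?S \<longleftrightarrow> ?F p \<in> ?T"
  proof
    assume "p \<in> ?S"
    then have ne: "\<forall>v\<in>?U. c v \<noteq> z"
      and *: "c \<in> proper_colourings Z \<pi> (M - replicate_mset (card B) z)"
      using count p by auto
    note same = proper_colouringsD(2)[OF *]
    have "?c \<in> ?T"
    proof (rule proper_colouringsI[OF F])
      fix u v assume uv: "u \<in> \<Union>(insert B \<pi>)" "v \<in> \<Union>(insert B \<pi>)" "?c u = ?c v"
      show "\<exists>C\<in>insert B \<pi>. u \<in> C \<and> v \<in> C"
      proof (cases "u \<in> B \<or> v \<in> B")
        case True
        have "u \<in> B \<and> v \<in> B"
        proof (rule ccontr)
          assume "\<not> (u \<in> B \<and> v \<in> B)"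
          then consider "u \<in> B" "v \<notin> B" | "u \<notin> B" "v \<in> B" using True by blast
          then show False
          proof cases
            case 1
            then have "c v = z" "v \<in> ?U" using uv by simp_all
            then show False using ne by blast
          next
            case 2
            then have "c u = z" "u \<in> ?U" using uv by simp_all
            then show False using ne by blast
          qed
        qed
        then show ?thesis by simp
      next
        case False
        then have "u \<in> ?U" "v \<in> ?U" "c u = c v" using uv by auto
        then show ?thesis using same[of u v] by blast
      qed
    qed
    then show "?F p \<in> ?T" using p by simp
  next
    assume "?F p \<in> ?T"
    then have "?c \<in> ?T" using p by simp
    note same = proper_colouringsD(2)[OF this]
    have "c v \<noteq> z" if "v \<in> ?U" for v
    proof
      assume "c v = z"
      then have "\<exists>C\<in>insert B \<pi>. b \<in> C \<and> v \<in> C" using same[of b v] b that out[OF that] by auto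
      then show False using b out[OF that] assms(3) by blast
    qed
    moreover have "c \<in> proper_colourings Z \<pi> (M - replicate_mset (card B) z)"
    proof (rule proper_colouringsI[OF c])
      fix u v assume uv: "u \<in> ?U" "v \<in> ?U" "c u = c v"
      then have "\<exists>C\<in>insert B \<pi>. u \<in> C \<and> v \<in> C"
        using same[of u v] out[OF uv(1)] out[OF uv(2)] by auto
      then show "\<exists>C\<in>\<pi>. u \<in> C \<and> v \<in> C" using out[OF uv(1)] by blast
    qed
    ultimately show "p \<in> ?S" using count z p by auto
  qed
qed

section \<open>Coefficients of power sums and of monomial symmetric functions\<close>

lemma mfps_eqI: "(\<And>M. mfps_coeff f M = mfps_coeff g M) \<Longrightarrow> f = g"
  by (simp add: mfps_coeff_inject[symmetric] fun_eq_iff)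

lemma mfps_coeff_0 [simp]: "mfps_coeff 0 M = 0"
  by transfer simp

lemma mfps_coeff_1: "mfps_coeff 1 M = (if M = {#} then 1 else 0)"
  by transfer simp

lemma mfps_coeff_add [simp]: "mfps_coeff (f + g) M = mfps_coeff f M + mfps_coeff g M"
  by transfer simp

lemma mfps_coeff_sum [simp]: "mfps_coeff (sum f A) M = (\<Sum>a\<in>A. mfps_coeff (f a) M)"
  by (induction A rule: infinite_finite_induct) auto

lemma mfps_coeff_mult:
  "mfps_coeff (f * g) M = (\<Sum>A | A \<subseteq># M. mfps_coeff f A * mfps_coeff g (M - A))"
  by transfer simp

lemma mfps_coeff_const_mult [simp]: "mfps_coeff (mfps_const a * f) M = a * mfps_coeff f M"
proof -
  have "mfps_coeff (mfps_const a * f) M =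
      (\<Sum>A\<in>{{#}}. mfps_coeff (mfps_const a) A * mfps_coeff f (M - A))"
    unfolding mfps_coeff_mult by (rule sum.mono_neutral_right) (auto simp: mfps_const.rep_eq)
  then show ?thesis by (simp add: mfps_const.rep_eq)
qed

lemma mfps_const_0: "mfps_const 0 = 0"
  by (rule mfps_eqI) (simp add: mfps_const.rep_eq)

lemma mfps_const_1: "mfps_const 1 = 1"
  by (rule mfps_eqI) (simp add: mfps_const.rep_eq mfps_coeff_1)

lemma mfps_const_add: "mfps_const (a + b) = mfps_const a + mfps_const b"
  by (rule mfps_eqI) (simp add: mfps_const.rep_eq)

lemma mfps_const_mult: "mfps_const (a * b) = mfps_const a * mfps_const b"
  by (rule mfps_eqI) (simp only: mfps_coeff_const_mult, simp add: mfps_const.rep_eq)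

lemma mfps_const_of_nat: "mfps_const (of_nat n) = of_nat n"
  by (induction n) (simp_all add: mfps_const_0 mfps_const_1 mfps_const_add)

lemma mfps_const_of_int: "mfps_const (of_int k) = of_int k"
proof (cases k)
  case (nonneg n)
  then show ?thesis by (simp add: mfps_const_of_nat)
next
  case (neg n)
  have "mfps_const (of_int k) + mfps_const (of_nat (Suc n)) = mfps_const (of_int k + of_nat (Suc n))"
    by (simp only: mfps_const_add)
  also have "\<dots> = 0" by (simp add: neg mfps_const_0)
  finally have "mfps_const (of_int k) = - mfps_const (of_nat (Suc n))"
    by (simp only: eq_neg_iff_add_eq_0)
  then show ?thesis by (simp only: mfps_const_of_nat neg) simp
qed

lemma mfps_coeff_power_sum_mult:
  assumes "k > 0"
  shows "mfps_coeff (power_sum Z k * f) M =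
    (\<Sum>z | z \<in> Z \<and> k \<le> count M z. mfps_coeff f (M - replicate_mset k z))"
proof -
  let ?R = "{z \<in> Z. k \<le> count M z}"
  have inj: "inj_on (replicate_mset k) ?R"
  proof (rule inj_onI)
    fix y z :: indet assume "replicate_mset k y = replicate_mset k z"
    then have "set_mset (replicate_mset k y) = set_mset (replicate_mset k z)" by simp
    then show "y = z" using assms by simp
  qed
  have "mfps_coeff (power_sum Z k * f) M =
      (\<Sum>A\<in>replicate_mset k ` ?R. mfps_coeff (power_sum Z k) A * mfps_coeff f (M - A))"
    unfolding mfps_coeff_mult
    by (rule sum.mono_neutral_right)
      (auto simp: power_sum.rep_eq count_le_replicate_mset_subset_eq)
  also have "\<dots> = (\<Sum>z\<in>?R. mfps_coeff (power_sum Z k) (replicate_mset k z) *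
      mfps_coeff f (M - replicate_mset k z))"
    by (simp add: sum.reindex[OF inj])
  also have "\<dots> = (\<Sum>z\<in>?R. mfps_coeff f (M - replicate_mset k z))"
    by (rule sum.cong) (auto simp: power_sum.rep_eq)
  finally show ?thesis .
qed

lemma finite_count_ge: "k > 0 \<Longrightarrow> finite {z. P z \<and> k \<le> count M z}"
  by (rule finite_subset[of _ "set_mset M"]) (auto simp flip: count_greater_zero_iff)

lemma power_sum_part_empty [simp]: "power_sum_part Z {#} = 1"
  by (simp add: power_sum_part_def)

lemma power_sum_part_add [simp]:
  "power_sum_part Z (add_mset k \<alpha>) = power_sum Z k * power_sum_part Z \<alpha>"
  by (simp add: power_sum_part_def)

lemma block_sizes_insert:
  "finite \<pi> \<Longrightarrow> B \<notin> \<pi> \<Longrightarrow> block_sizes (insert B \<pi>) = add_mset (card B) (block_sizes \<pi>)"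
  by (simp add: block_sizes_def)

lemma block_sizes_empty [simp]: "block_sizes {} = {#}"
  by (simp add: block_sizes_def)

lemma colourings_empty: "colourings Z {} M = (if M = {#} then {\<lambda>_. undefined} else {})"
  by (auto simp: colourings_def)

lemma proper_colourings_empty: "proper_colourings Z {} M = (if M = {#} then {\<lambda>_. undefined} else {})"
  by (auto simp: proper_colourings_def colourings_empty)

lemma partition_on_insertD:
  assumes "finite V" "partition_on V (insert B \<pi>)" "B \<notin> \<pi>"
  shows "B \<inter> \<Union>\<pi> = {}" "partition_on (\<Union>\<pi>) \<pi>" "finite B" "finite (\<Union>\<pi>)" "card B > 0"
proof -
  have "B \<inter> C = {}" if "C \<in> \<pi>" for C
    using disjointD[OF partition_onD2[OF assms(2)], of B C] that assms(3) by auto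
  then show "B \<inter> \<Union>\<pi> = {}" by blast
  show "partition_on (\<Union>\<pi>) \<pi>"
    using assms(2) by (auto simp: partition_on_def pairwise_insert)
  have V: "V = B \<union> \<Union>\<pi>" "B \<noteq> {}" using assms(2) by (auto simp: partition_on_def)
  then show "finite B" "finite (\<Union>\<pi>)" using assms(1) by simp_all
  then show "card B > 0" using V(2) by (simp add: card_gt_0_iff)
qed

lemma coeff_power_sum_part:
  assumes "finite V" "partition_on V \<pi>"
  shows "mfps_coeff (power_sum_part Z (block_sizes \<pi>)) M = of_nat (card (colourings Z \<pi> M))"
proof -
  have "finite \<pi>" using assms by (rule finite_elements)
  then show ?thesis using assms
  proof (induction \<pi> arbitrary: V M rule: finite_induct)
    case empty
    then show ?case by (simp add: mfps_coeff_1 colourings_empty)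
  next
    case (insert B \<pi>)
    note parts = partition_on_insertD[OF insert.prems insert.hyps(2)]
    note disj = parts(1) and part = parts(2) and fin = parts(3,4) and pos = parts(5)
    have ne: "B \<noteq> {}" using pos by auto
    have "mfps_coeff (power_sum_part Z (block_sizes (insert B \<pi>))) M =
        (\<Sum>z | z \<in> Z \<and> card B \<le> count M z. of_nat (card (colourings Z \<pi> (M - replicate_mset (card B) z))))"
      using insert.hyps insert.IH[OF fin(2) part]
      by (simp add: block_sizes_insert mfps_coeff_power_sum_mult[OF pos])
    also have "\<dots> = of_nat (card (SIGMA z:{z\<in>Z. card B \<le> count M z}.
        colourings Z \<pi> (M - replicate_mset (card B) z)))"
      using fin by (subst card_SigmaI) (auto simp: finite_colourings finite_count_ge[OF pos])
    also have "\<dots> = of_nat (card (colourings Z (insert B \<pi>) M))"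
      using bij_betw_same_card[OF colourings_insert[OF fin disj ne, of Z M]] by simp
    finally show ?case .
  qed
qed

lemma diff_replicate_add: "k \<le> count M z \<Longrightarrow> M - replicate_mset k z + replicate_mset k z = M"
  by (simp add: count_le_replicate_mset_subset_eq)

lemma exponents_add_replicate:
  assumes "z \<notin># M" "k > 0"
  shows "exponents (M + replicate_mset k z) = add_mset k (exponents M)"
proof -
  have "exponents (M + replicate_mset k z) =
      image_mset (count (M + replicate_mset k z)) (mset_set (insert z (set_mset M)))"
    using assms(2) by (simp add: exponents_def)
  also have "\<dots> = add_mset (count (M + replicate_mset k z) z)
      (image_mset (count (M + replicate_mset k z)) (mset_set (set_mset M)))"
    using assms(1) by simp
  also have "image_mset (count (M + replicate_mset k z)) (mset_set (set_mset M)) = exponents M"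
    unfolding exponents_def using assms(1) by (intro image_mset_cong) auto
  also have "count (M + replicate_mset k z) z = k" using assms by (simp add: not_in_iff)
  finally show ?thesis .
qed

lemma exponents_diff_replicate:
  assumes "count M z = k" "k > 0"
  shows "exponents M = add_mset k (exponents (M - replicate_mset k z))"
proof -
  have "M = (M - replicate_mset k z) + replicate_mset k z"
    using assms by (intro diff_replicate_add[symmetric]) simp
  moreover have "z \<notin># M - replicate_mset k z" using assms by (simp add: not_in_iff)
  ultimately show ?thesis using exponents_add_replicate assms(2) by metis
qed

lemma count_exponents:
  assumes "k > 0"
  shows "count (exponents M) k = card {z. count M z = k}"
proof -
  have "count (exponents M) k = card {z. z \<in># M \<and> count M z = k}"
    by (simp add: exponents_def count_image_mset' eq_commute[of k])
  also have "{z. z \<in># M \<and> count M z = k} = {z. count M z = k}"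
    using assms by (auto simp flip: count_greater_zero_iff)
  finally show ?thesis .
qed

text \<open>
  The factor \<open>r\<^sub>1! r\<^sub>2! \<dots>\<close> of the augmented monomial functions: the number of permutations of the
  parts that preserve their sizes.
\<close>

definition aut_count :: "nat multiset \<Rightarrow> nat" where
  "aut_count \<alpha> = (\<Prod>i\<in>set_mset \<alpha>. fact (count \<alpha> i))"

lemma aut_count_superset:
  assumes "finite A" "set_mset \<alpha> \<subseteq> A"
  shows "aut_count \<alpha> = (\<Prod>i\<in>A. fact (count \<alpha> i))"
  unfolding aut_count_def using assms
  by (intro prod.mono_neutral_left) (auto simp: not_in_iff)

lemma aut_count_add: "aut_count (add_mset k \<alpha>) = (count \<alpha> k + 1) * aut_count \<alpha>"
proof -
  let ?A = "insert k (set_mset \<alpha>)"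
  have "aut_count (add_mset k \<alpha>) = (\<Prod>i\<in>?A. fact (count (add_mset k \<alpha>) i))"
    by (rule aut_count_superset) auto
  also have "\<dots> = fact (count \<alpha> k + 1) * (\<Prod>i\<in>set_mset \<alpha> - {k}. fact (count \<alpha> i))"
    by (subst prod.insert_remove) (auto intro!: prod.cong)
  also have "\<dots> = (count \<alpha> k + 1) * (fact (count \<alpha> k) * (\<Prod>i\<in>set_mset \<alpha> - {k}. fact (count \<alpha> i)))"
    by (simp add: algebra_simps)
  also have "fact (count \<alpha> k) * (\<Prod>i\<in>set_mset \<alpha> - {k}. fact (count \<alpha> i)) = (\<Prod>i\<in>?A. fact (count \<alpha> i))"
    by (subst prod.insert_remove) auto
  also have "\<dots> = aut_count \<alpha>"
    by (rule aut_count_superset[symmetric]) auto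
  finally show ?thesis .
qed

lemma coeff_aug_monomial_sym:
  "mfps_coeff (aug_monomial_sym Z \<alpha>) M =
    (if set_mset M \<subseteq> Z \<and> exponents M = \<alpha> then of_nat (aut_count \<alpha>) else 0)"
  unfolding aug_monomial_sym_def aut_count_def[symmetric]
  by (simp only: mfps_const_of_nat[symmetric] mfps_coeff_const_mult) (simp add: monomial_sym.rep_eq)

text \<open>
  Each \<open>z\<close> of multiplicity \<open>k\<close> may be matched with the new part \<open>k\<close>. There are as many of them as
  the enlarged partition has parts \<open>k\<close>, and this is the factor by which \<open>aut_count\<close> grows.
\<close>

lemma coeff_aug_monomial_sym_add:
  assumes "k > 0"
  shows "mfps_coeff (aug_monomial_sym Z (add_mset k \<alpha>)) M =
    (\<Sum>z | z \<in> Z \<and> count M z = k. mfps_coeff (aug_monomial_sym Z \<alpha>) (M - replicate_mset k z))"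
proof (cases "set_mset M \<subseteq> Z \<and> exponents M = add_mset k \<alpha>")
  case True
  have Z: "{z. z \<in> Z \<and> count M z = k} = {z. count M z = k}"
    using True assms by (auto simp flip: count_greater_zero_iff)
  have "mfps_coeff (aug_monomial_sym Z \<alpha>) (M - replicate_mset k z) = of_nat (aut_count \<alpha>)"
    if "count M z = k" for z
  proof -
    have "exponents (M - replicate_mset k z) = \<alpha>"
      using exponents_diff_replicate[OF that assms] True by simp
    moreover have "set_mset (M - replicate_mset k z) \<subseteq> Z"
      using True by (auto dest: in_diffD)
    ultimately show ?thesis by (simp add: coeff_aug_monomial_sym)
  qed
  then have "(\<Sum>z | z \<in> Z \<and> count M z = k. mfps_coeff (aug_monomial_sym Z \<alpha>) (M - replicate_mset k z)) =
      of_nat (card {z. count M z = k}) * of_nat (aut_count \<alpha>)"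
    unfolding Z by simp
  also have "card {z. count M z = k} = count \<alpha> k + 1"
    using count_exponents[OF assms, of M] True by simp
  finally show ?thesis using True by (simp add: coeff_aug_monomial_sym aut_count_add algebra_simps)
next
  case False
  have "mfps_coeff (aug_monomial_sym Z \<alpha>) (M - replicate_mset k z) = 0"
    if z: "z \<in> Z" "count M z = k" for z
  proof (rule ccontr)
    assume "mfps_coeff (aug_monomial_sym Z \<alpha>) (M - replicate_mset k z) \<noteq> 0"
    then have *: "set_mset (M - replicate_mset k z) \<subseteq> Z" "exponents (M - replicate_mset k z) = \<alpha>"
      by (auto simp: coeff_aug_monomial_sym split: if_splits)
    have "M = (M - replicate_mset k z) + replicate_mset k z"
      using z by (intro diff_replicate_add[symmetric]) simp
    then have "set_mset M \<subseteq> set_mset (M - replicate_mset k z) \<union> {z}"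
      by (metis set_mset_replicate_mset_subset set_mset_union Un_mono order_refl empty_subsetI)
    then have "set_mset M \<subseteq> Z" using * z by blast
    with exponents_diff_replicate[OF z(2) assms] * False show False by simp
  qed
  then show ?thesis using False by (auto simp: coeff_aug_monomial_sym)
qed

lemma coeff_aug_monomial_sym_block_sizes:
  assumes "finite V" "partition_on V \<pi>"
  shows "mfps_coeff (aug_monomial_sym Z (block_sizes \<pi>)) M = of_nat (card (proper_colourings Z \<pi> M))"
proof -
  have "finite \<pi>" using assms by (rule finite_elements)
  then show ?thesis using assms
  proof (induction \<pi> arbitrary: V M rule: finite_induct)
    case empty
    show ?case
      by (auto simp: coeff_aug_monomial_sym proper_colourings_empty exponents_def aut_count_def mset_set_empty_iff)
  next
    case (insert B \<pi>)
    note parts = partition_on_insertD[OF insert.prems insert.hyps(2)]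
    note disj = parts(1) and part = parts(2) and fin = parts(3,4) and pos = parts(5)
    have ne: "B \<noteq> {}" using pos by auto
    have fin': "finite {z \<in> Z. count M z = card B}"
      by (rule finite_subset[OF _ finite_count_ge[OF pos, of "\<lambda>_. True" M]]) auto
    have "mfps_coeff (aug_monomial_sym Z (block_sizes (insert B \<pi>))) M =
        (\<Sum>z | z \<in> Z \<and> count M z = card B. of_nat (card (proper_colourings Z \<pi> (M - replicate_mset (card B) z))))"
      using insert.hyps insert.IH[OF fin(2) part]
      by (simp add: block_sizes_insert coeff_aug_monomial_sym_add[OF pos])
    also have "\<dots> = of_nat (card (SIGMA z:{z\<in>Z. count M z = card B}.
        proper_colourings Z \<pi> (M - replicate_mset (card B) z)))"
      using fin fin' by (subst card_SigmaI) (auto simp: finite_proper_colourings)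
    also have "\<dots> = of_nat (card (proper_colourings Z (insert B \<pi>) M))"
      using bij_betw_same_card[OF proper_colourings_insert[OF fin disj ne, of Z M]] by simp
    finally show ?case .
  qed
qed

section \<open>Moebius inversion between power sums and augmented monomial functions\<close>

text \<open>
  Every colouring that is constant on the blocks of \<open>\<pi>\<close> is proper for exactly one partition
  coarser than \<open>\<pi>\<close>, the one into colour classes.
\<close>

lemma power_sum_part_as_aug_monomial_sum:
  assumes "finite V" "partition_on V \<pi>"
  shows "power_sum_part Z (block_sizes \<pi>) =
    (\<Sum>\<sigma> | refines V \<pi> \<sigma>. aug_monomial_sym Z (block_sizes \<sigma>))"
proof (rule mfps_eqI)
  fix M
  have V: "\<Union>\<sigma> = V" if "refines V \<pi> \<sigma>" for \<sigma>
    using refines_partition(2)[OF that] by (simp add: partition_on_def)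
  have VP: "\<Union>\<pi> = V" using assms(2) by (simp add: partition_on_def)
  have "colourings Z \<pi> M = (\<Union>\<sigma>\<in>{\<sigma>. refines V \<pi> \<sigma>}. proper_colourings Z \<sigma> M)"
  proof (intro equalityI subsetI)
    fix c assume c: "c \<in> colourings Z \<pi> M"
    define \<sigma> where "\<sigma> = (\<lambda>z. {v \<in> V. c v = z}) ` c ` V"
    have part: "partition_on V \<sigma>"
      unfolding \<sigma>_def by (rule partition_onI) (auto simp: disjnt_def)
    have ref: "refines V \<pi> \<sigma>"
      unfolding refines_def
    proof (intro conjI ballI part assms(2))
      fix B assume B: "B \<in> \<pi>"
      then have "B \<noteq> {}" "B \<subseteq> V" using assms(2) by (auto simp: partition_on_def)
      then obtain b where b: "b \<in> B" "b \<in> V" by blast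
      have "B \<subseteq> {v \<in> V. c v = c b}" using colouringsD(2)[OF c B _ b(1)] B VP by blast
      then show "\<exists>C\<in>\<sigma>. B \<subseteq> C" unfolding \<sigma>_def using b(2) by blast
    qed
    have "c \<in> colourings Z \<sigma> M"
    proof (rule colouringsI)
      show "c \<in> \<Union>\<sigma> \<rightarrow>\<^sub>E Z" "image_mset c (mset_set (\<Union>\<sigma>)) = M"
        using colouringsD(1,3)[OF c] by (simp_all only: V[OF ref] VP)
    qed (auto simp: \<sigma>_def)
    then have "c \<in> proper_colourings Z \<sigma> M"
    proof (rule proper_colouringsI)
      fix u v assume "u \<in> \<Union>\<sigma>" "v \<in> \<Union>\<sigma>" "c u = c v"
      then have "u \<in> V" "v \<in> V" "c u = c v" by (simp_all only: V[OF ref])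
      then show "\<exists>B\<in>\<sigma>. u \<in> B \<and> v \<in> B" by (auto simp: \<sigma>_def)
    qed
    then show "c \<in> (\<Union>\<sigma>\<in>{\<sigma>. refines V \<pi> \<sigma>}. proper_colourings Z \<sigma> M)" using ref by blast
  next
    fix c assume "c \<in> (\<Union>\<sigma>\<in>{\<sigma>. refines V \<pi> \<sigma>}. proper_colourings Z \<sigma> M)"
    then obtain \<sigma> where ref: "refines V \<pi> \<sigma>" and "c \<in> proper_colourings Z \<sigma> M" by blast
    then have c: "c \<in> colourings Z \<sigma> M" by (blast dest: proper_colouringsD)
    show "c \<in> colourings Z \<pi> M"
    proof (rule colouringsI)
      show "c \<in> \<Union>\<pi> \<rightarrow>\<^sub>E Z" "image_mset c (mset_set (\<Union>\<pi>)) = M"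
        using colouringsD(1,3)[OF c] V[OF ref] VP by simp_all
      fix B u v assume "B \<in> \<pi>" "u \<in> B" "v \<in> B"
      with refines_block[OF ref, of B] colouringsD(2)[OF c] show "c u = c v" by blast
    qed
  qed
  moreover have "\<sigma> = \<tau>" if "refines V \<pi> \<sigma>" "refines V \<pi> \<tau>"
    "c \<in> proper_colourings Z \<sigma> M" "c \<in> proper_colourings Z \<tau> M" for c \<sigma> \<tau>
  proof -
    have sub: "refines V \<sigma> \<tau>" if st: "refines V \<pi> \<sigma>" "refines V \<pi> \<tau>"
      "c \<in> proper_colourings Z \<sigma> M" "c \<in> proper_colourings Z \<tau> M" for \<sigma> \<tau>
      unfolding refines_def
    proof (intro conjI ballI refines_partition(2)[OF st(1)] refines_partition(2)[OF st(2)])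
      have part: "partition_on V \<tau>" by (rule refines_partition(2)[OF st(2)])
      fix B assume B: "B \<in> \<sigma>"
      have "B \<noteq> {}" using refines_partition(2)[OF st(1)] B by (auto simp: partition_on_def)
      then obtain b where b: "b \<in> B" by blast
      have BV: "B \<subseteq> V" using V[OF st(1)] B by blast
      then obtain C where C: "C \<in> \<tau>" "b \<in> C" using b V[OF st(2)] by blast
      have "v \<in> C" if v: "v \<in> B" for v
      proof -
        have "c b = c v" using colouringsD(2)[OF proper_colouringsD(1)[OF st(3)] B b v] .
        then obtain C' where "C' \<in> \<tau>" "b \<in> C'" "v \<in> C'"
          using proper_colouringsD(2)[OF st(4), of b v]
            V[OF st(2)] b v BV by blast
        moreover have "C' = C"
          using part C calculation unfolding partition_on_def disjoint_def by blast
        ultimately show ?thesis by simp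
      qed
      then show "\<exists>C\<in>\<tau>. B \<subseteq> C" using C by blast
    qed
    show ?thesis using sub[OF that] sub[OF that(2,1,4,3)] by (rule refines_asym)
  qed
  ultimately have "card (colourings Z \<pi> M) = (\<Sum>\<sigma> | refines V \<pi> \<sigma>. card (proper_colourings Z \<sigma> M))"
    using assms(1) V
    by (auto intro!: card_UN_disjoint simp: finite_refines_left finite_proper_colourings)
  then show "mfps_coeff (power_sum_part Z (block_sizes \<pi>)) M =
      mfps_coeff (\<Sum>\<sigma> | refines V \<pi> \<sigma>. aug_monomial_sym Z (block_sizes \<sigma>)) M"
    using coeff_aug_monomial_sym_block_sizes[OF assms(1) refines_partition(2)]
    by (simp add: coeff_power_sum_part[OF assms])
qed

text \<open>
  Substituting the previous expansion leaves, at each \<open>\<tau>\<close>, the sum of \<open>\<mu>(\<pi>, \<sigma>)\<close> over the interval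
  from \<open>\<pi>\<close> to \<open>\<tau>\<close>, which vanishes unless \<open>\<tau> = \<pi>\<close>.
\<close>

lemma aug_monomial_sym_as_power_sums:
  assumes "finite V" "partition_on V \<pi>"
  shows "aug_monomial_sym Z (block_sizes \<pi>) =
    (\<Sum>\<sigma> | refines V \<pi> \<sigma>. of_int (partition_moebius V \<pi> \<sigma>) * power_sum_part Z (block_sizes \<sigma>))"
proof -
  let ?U = "\<lambda>\<rho>. {\<sigma>. refines V \<rho> \<sigma>}"
  let ?m = "\<lambda>\<sigma>. aug_monomial_sym Z (block_sizes \<sigma>)"
  have "(\<Sum>\<sigma>\<in>?U \<pi>. of_int (partition_moebius V \<pi> \<sigma>) * power_sum_part Z (block_sizes \<sigma>)) =
      (\<Sum>\<sigma>\<in>?U \<pi>. \<Sum>\<tau>\<in>?U \<sigma>. of_int (partition_moebius V \<pi> \<sigma>) * ?m \<tau>)"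
    using power_sum_part_as_aug_monomial_sum[OF assms(1) refines_partition(2)]
    by (simp add: sum_distrib_left)
  also have "\<dots> = (\<Sum>\<sigma>\<in>?U \<pi>. \<Sum>\<tau>\<in>{\<tau>\<in>?U \<pi>. refines V \<sigma> \<tau>}. of_int (partition_moebius V \<pi> \<sigma>) * ?m \<tau>)"
    by (intro sum.cong refl) (auto intro: refines_trans)
  also have "\<dots> = (\<Sum>\<tau>\<in>?U \<pi>. \<Sum>\<sigma>\<in>{\<sigma>\<in>?U \<pi>. refines V \<sigma> \<tau>}. of_int (partition_moebius V \<pi> \<sigma>) * ?m \<tau>)"
    by (rule sum.swap_restrict) (simp_all add: finite_refines_left assms(1))
  also have "\<dots> = (\<Sum>\<tau>\<in>?U \<pi>. if \<pi> = \<tau> then ?m \<tau> else 0)"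
  proof (rule sum.cong[OF refl])
    fix \<tau> assume "\<tau> \<in> ?U \<pi>"
    then have "(\<Sum>\<sigma>\<in>{\<sigma>\<in>?U \<pi>. refines V \<sigma> \<tau>}. partition_moebius V \<pi> \<sigma>) = (if \<pi> = \<tau> then 1 else 0)"
      using sum_partition_moebius_interval[OF assms(1), of \<pi> \<tau>] by simp
    then show "(\<Sum>\<sigma>\<in>{\<sigma>\<in>?U \<pi>. refines V \<sigma> \<tau>}. of_int (partition_moebius V \<pi> \<sigma>) * ?m \<tau>) =
        (if \<pi> = \<tau> then ?m \<tau> else 0)"
      by (simp flip: sum_distrib_right of_int_sum)
  qed
  also have "\<dots> = ?m \<pi>"
    using refines_refl[OF assms(2)] by (simp add: finite_refines_left assms(1) sum.delta)
  finally show ?thesis by simp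
qed

section \<open>Derivatives of polynomials in the power sums\<close>

lemma size_exponents: "size (exponents M) = card (set_mset M)"
  by (simp add: exponents_def)

lemma coeff_power_sum_part_nonneg:
  "0 \<notin># \<alpha> \<Longrightarrow> mfps_coeff (power_sum_part Z \<alpha>) M \<ge> 0"
proof (induction \<alpha> arbitrary: M)
  case (add k \<alpha>)
  then show ?case by (auto simp: mfps_coeff_power_sum_mult intro!: sum_nonneg)
qed (simp add: mfps_coeff_1)

lemma coeff_power_sum_part_pos:
  assumes "0 \<notin># \<alpha>" "set_mset M \<subseteq> Z" "exponents M = \<alpha>"
  shows "mfps_coeff (power_sum_part Z \<alpha>) M > 0"
  using assms
proof (induction \<alpha> arbitrary: M)
  case empty
  then have "M = {#}" using size_exponents[of M] by simp
  then show ?case by (simp add: mfps_coeff_1)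
next
  case (add k \<alpha>)
  have k: "k > 0" using add.prems(1) by auto
  have "count (exponents M) k > 0" using add.prems(3) by simp
  then have "{z. count M z = k} \<noteq> {}" unfolding count_exponents[OF k] by (metis card.empty less_irrefl)
  then obtain z where z: "count M z = k" by blast
  then have zZ: "z \<in> Z" using k add.prems(2) by (metis count_greater_zero_iff subsetD)
  have "mfps_coeff (power_sum_part Z \<alpha>) (M - replicate_mset k z) > 0"
  proof (rule add.IH)
    show "exponents (M - replicate_mset k z) = \<alpha>"
      using exponents_diff_replicate[OF z k] add.prems(3) by simp
  qed (use add.prems in \<open>auto dest: in_diffD\<close>)
  then have "(\<Sum>z | z \<in> Z \<and> k \<le> count M z. mfps_coeff (power_sum_part Z \<alpha>) (M - replicate_mset k z)) > 0"
    using z zZ add.prems(1) finite_count_ge[OF k]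
    by (intro sum_pos2[where i = z]) (auto intro!: coeff_power_sum_part_nonneg)
  then show ?case by (simp add: mfps_coeff_power_sum_mult[OF k])
qed

text \<open>
  Multiplying by a power sum adds its exponent to that of one indeterminate, so a monomial of
  \<open>p\<^sub>\<alpha>\<close> arises from \<open>\<alpha>\<close> by merging parts: it has at most as many indeterminates as \<open>\<alpha>\<close> has parts.
\<close>

lemma coeff_power_sum_part_nonzero:
  assumes "0 \<notin># \<alpha>" "mfps_coeff (power_sum_part Z \<alpha>) M \<noteq> 0"
  shows "card (set_mset M) \<le> size \<alpha>"
    and "card (set_mset M) = size \<alpha> \<Longrightarrow> exponents M = \<alpha>"
proof -
  have "card (set_mset M) \<le> size \<alpha> \<and> (card (set_mset M) = size \<alpha> \<longrightarrow> exponents M = \<alpha>)"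
    using assms
  proof (induction \<alpha> arbitrary: M)
    case empty
    then show ?case by (simp add: mfps_coeff_1 exponents_def split: if_splits)
  next
    case (add k \<alpha>)
    have k: "k > 0" using add.prems(1) by auto
    have "(\<Sum>z | z \<in> Z \<and> k \<le> count M z. mfps_coeff (power_sum_part Z \<alpha>) (M - replicate_mset k z)) \<noteq> 0"
      using add.prems(2) by (simp add: mfps_coeff_power_sum_mult[OF k])
    then obtain z where z: "k \<le> count M z" "mfps_coeff (power_sum_part Z \<alpha>) (M - replicate_mset k z) \<noteq> 0"
      by (rule sum.not_neutral_contains_not_neutral) (use that in blast)
    let ?N = "M - replicate_mset k z"
    have M: "M = ?N + replicate_mset k z" using diff_replicate_add[OF z(1)] by simp
    have "set_mset (?N + replicate_mset k z) = insert z (set_mset ?N)" using k by auto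
    then have set: "set_mset M = insert z (set_mset ?N)"
      by (simp only: diff_replicate_add[OF z(1)])
    have IH: "card (set_mset ?N) \<le> size \<alpha> \<and> (card (set_mset ?N) = size \<alpha> \<longrightarrow> exponents ?N = \<alpha>)"
      using add.prems(1) z(2) by (intro add.IH) auto
    show ?case
    proof (cases "z \<in># ?N")
      case True
      then have "set_mset M = set_mset ?N" using set by (simp add: insert_absorb)
      then show ?thesis using IH by simp
    next
      case False
      then have "card (set_mset M) = Suc (card (set_mset ?N))" using set by simp
      moreover have "exponents M = add_mset k (exponents ?N)"
        using exponents_add_replicate[OF False k] M by simp
      ultimately show ?thesis using IH by simp
    qed
  qed
  then show "card (set_mset M) \<le> size \<alpha>" "card (set_mset M) = size \<alpha> \<Longrightarrow> exponents M = \<alpha>"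
    by blast+
qed

lemma ex_monomial_exponents:
  assumes "0 \<notin># \<alpha>" "infinite Z"
  shows "\<exists>M. set_mset M \<subseteq> Z \<and> exponents M = \<alpha>"
  using assms(1)
proof (induction \<alpha>)
  case empty
  then show ?case by (intro exI[of _ "{#}"]) (simp add: exponents_def)
next
  case (add k \<alpha>)
  then obtain M where M: "set_mset M \<subseteq> Z" "exponents M = \<alpha>" by auto
  obtain z where z: "z \<in> Z" "z \<notin># M"
    using assms(2) by (metis finite_set_mset finite_subset subsetI)
  have k: "k > 0" using add.prems by auto
  have "set_mset (M + replicate_mset k z) \<subseteq> Z" using M z by (auto split: if_splits)
  moreover have "exponents (M + replicate_mset k z) = add_mset k \<alpha>"
    using exponents_add_replicate[OF z(2) k] M by simp
  ultimately show ?case by blast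
qed

lemma ppoly_eval_superset:
  assumes "finite A" "Poly_Mapping.keys P \<subseteq> A"
  shows "ppoly_eval P = (\<Sum>\<alpha>\<in>A. mfps_const (Poly_Mapping.lookup P \<alpha>) * power_sum_part (range X) \<alpha>)"
  unfolding ppoly_eval_def using assms
  by (intro sum.mono_neutral_left) (auto simp: in_keys_iff mfps_const_0)

lemma ppoly_deriv_superset:
  assumes "finite A" "Poly_Mapping.keys P \<subseteq> A"
  shows "ppoly_deriv i P = (\<Sum>\<alpha>\<in>A.
    Poly_Mapping.single (\<alpha> - {#i#}) (of_nat (count \<alpha> i) * Poly_Mapping.lookup P \<alpha>))"
  unfolding ppoly_deriv_def using assms
  by (intro sum.mono_neutral_left) (auto simp: in_keys_iff)

lemma ppoly_eval_add: "ppoly_eval (P + Q) = ppoly_eval P + ppoly_eval Q"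
proof -
  let ?A = "Poly_Mapping.keys P \<union> Poly_Mapping.keys Q"
  have "Poly_Mapping.keys (P + Q) \<subseteq> ?A" by (rule Poly_Mapping.keys_add)
  then show ?thesis
    by (simp add: ppoly_eval_superset[of ?A] lookup_add mfps_const_add distrib_right sum.distrib)
qed

lemma ppoly_deriv_add: "ppoly_deriv i (P + Q) = ppoly_deriv i P + ppoly_deriv i Q"
proof -
  let ?A = "Poly_Mapping.keys P \<union> Poly_Mapping.keys Q"
  have "Poly_Mapping.keys (P + Q) \<subseteq> ?A" by (rule Poly_Mapping.keys_add)
  then show ?thesis
    by (simp add: ppoly_deriv_superset[of ?A] lookup_add distrib_left single_add sum.distrib)
qed

lemma ppoly_eval_single:
  "ppoly_eval (Poly_Mapping.single \<alpha> c) = mfps_const c * power_sum_part (range X) \<alpha>"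
  by (subst ppoly_eval_superset[of "{\<alpha>}"]) auto

lemma ppoly_deriv_single:
  "ppoly_deriv i (Poly_Mapping.single \<alpha> c) = Poly_Mapping.single (\<alpha> - {#i#}) (of_nat (count \<alpha> i) * c)"
  by (subst ppoly_deriv_superset[of "{\<alpha>}"]) auto

lemma ppoly_eval_sum: "ppoly_eval (sum f J) = (\<Sum>j\<in>J. ppoly_eval (f j))"
  by (induction J rule: infinite_finite_induct) (simp_all add: ppoly_eval_add, simp_all add: ppoly_eval_def)

lemma ppoly_deriv_sum: "ppoly_deriv i (sum f J) = (\<Sum>j\<in>J. ppoly_deriv i (f j))"
  by (induction J rule: infinite_finite_induct) (simp_all add: ppoly_deriv_add, simp_all add: ppoly_deriv_def)

lemma is_ppoly_sum:
  assumes "\<And>j. j \<in> J \<Longrightarrow> is_ppoly (f j)"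
  shows "is_ppoly (sum f J)"
  using assms
proof (induction J rule: infinite_finite_induct)
  case (insert j J)
  then have "is_ppoly (f j)" "is_ppoly (sum f J)" by simp_all
  moreover have "Poly_Mapping.keys (f j + sum f J) \<subseteq> Poly_Mapping.keys (f j) \<union> Poly_Mapping.keys (sum f J)"
    by (rule Poly_Mapping.keys_add)
  ultimately have "is_ppoly (f j + sum f J)" unfolding is_ppoly_def by blast
  then show ?case using insert.hyps by simp
qed (simp_all add: is_ppoly_def)

text \<open>
  The algebraic independence of the power sums. Among the partitions at which two polynomials
  differ take one, \<open>\<alpha>\<close>, with the largest number of parts; a monomial with exponents \<open>\<alpha>\<close> occurs
  in \<open>p\<^sub>\<alpha>\<close> but in no other \<open>p\<^sub>\<beta>\<close> with at most as many parts.
\<close>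

lemma ppoly_eval_inject:
  assumes "is_ppoly P" "is_ppoly Q" "ppoly_eval P = ppoly_eval Q"
  shows "P = Q"
proof (rule ccontr)
  assume "P \<noteq> Q"
  let ?A = "Poly_Mapping.keys P \<union> Poly_Mapping.keys Q"
  let ?d = "\<lambda>\<beta>. Poly_Mapping.lookup P \<beta> - Poly_Mapping.lookup Q \<beta>"
  let ?p = "power_sum_part (range X)"
  define K where "K = {\<beta>. ?d \<beta> \<noteq> 0}"
  have KA: "K \<subseteq> ?A" by (auto simp: K_def in_keys_iff)
  then have "finite K" by (rule finite_subset) simp
  have "K \<noteq> {}" using \<open>P \<noteq> Q\<close> by (auto simp: K_def poly_mapping_eq_iff fun_eq_iff)
  define m where "m = Max (size ` K)"
  have "m \<in> size ` K" unfolding m_def using \<open>finite K\<close> \<open>K \<noteq> {}\<close> by (intro Max_in) auto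
  then obtain \<alpha> where \<alpha>: "\<alpha> \<in> K" "size \<alpha> = m" by blast
  have max: "size \<beta> \<le> size \<alpha>" if "\<beta> \<in> K" for \<beta>
    using that \<open>finite K\<close> \<alpha>(2) by (simp add: m_def)
  have pos: "0 \<notin># \<beta>" if "\<beta> \<in> ?A" for \<beta> using that assms(1,2) by (auto simp: is_ppoly_def)
  have "infinite (range X)" by (rule range_inj_infinite) (simp add: inj_def)
  then obtain M where M: "set_mset M \<subseteq> range X" "exponents M = \<alpha>"
    using ex_monomial_exponents[of \<alpha>] pos \<alpha>(1) KA by blast
  have coeff: "mfps_coeff (ppoly_eval R) M = (\<Sum>\<beta>\<in>?A. Poly_Mapping.lookup R \<beta> * mfps_coeff (?p \<beta>) M)"
    if "Poly_Mapping.keys R \<subseteq> ?A" for R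
    by (subst ppoly_eval_superset[OF _ that]) simp_all
  have "0 = mfps_coeff (ppoly_eval P) M - mfps_coeff (ppoly_eval Q) M" using assms(3) by simp
  also have "\<dots> = (\<Sum>\<beta>\<in>?A. ?d \<beta> * mfps_coeff (?p \<beta>) M)"
    by (simp add: coeff left_diff_distrib sum_subtractf)
  also have "\<dots> = (\<Sum>\<beta>\<in>{\<alpha>}. ?d \<beta> * mfps_coeff (?p \<beta>) M)"
  proof (rule sum.mono_neutral_right)
    show "\<forall>\<beta>\<in>?A - {\<alpha>}. ?d \<beta> * mfps_coeff (?p \<beta>) M = 0"
    proof
      fix \<beta> assume \<beta>: "\<beta> \<in> ?A - {\<alpha>}"
      show "?d \<beta> * mfps_coeff (?p \<beta>) M = 0"
      proof (rule ccontr)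
        assume "?d \<beta> * mfps_coeff (?p \<beta>) M \<noteq> 0"
        then have d: "\<beta> \<in> K" and nz: "mfps_coeff (?p \<beta>) M \<noteq> 0" by (auto simp: K_def)
        have "0 \<notin># \<beta>" using pos \<beta> by blast
        note * = coeff_power_sum_part_nonzero[OF this nz]
        have "size \<alpha> \<le> size \<beta>" using *(1) M(2) size_exponents[of M] by simp
        then have "exponents M = \<beta>" using max[OF d] *(2) M(2) size_exponents[of M] by simp
        then show False using \<beta> M(2) by simp
      qed
    qed
  qed (use \<alpha>(1) KA in auto)
  also have "\<dots> \<noteq> 0"
  proof -
    have "0 \<notin># \<alpha>" using pos \<alpha>(1) KA by blast
    from coeff_power_sum_part_pos[OF this M] have "mfps_coeff (?p \<alpha>) M \<noteq> 0" by simp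
    moreover have "?d \<alpha> \<noteq> 0" using \<alpha>(1) by (simp add: K_def)
    ultimately show ?thesis by simp
  qed
  finally show False by simp
qed

text \<open>
  The family \<open>\<alpha>\<close> may repeat partitions, so a series can be differentiated termwise without
  collecting equal products of power sums first.
\<close>

lemma p_deriv_power_sums:
  assumes "\<And>j. j \<in> J \<Longrightarrow> 0 \<notin># \<alpha> j"
  shows "p_deriv i (\<Sum>j\<in>J. of_int (c j) * power_sum_part (range X) (\<alpha> j)) =
    (\<Sum>j\<in>J. of_int (c j) * (of_nat (count (\<alpha> j) i) * power_sum_part (range X) (\<alpha> j - {#i#})))"
proof -
  define P where "P = (\<Sum>j\<in>J. Poly_Mapping.single (\<alpha> j) (of_int (c j) :: rat))"
  have "is_ppoly P"
    unfolding P_def using assms by (intro is_ppoly_sum) (auto simp: is_ppoly_def)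
  moreover have "ppoly_eval P = (\<Sum>j\<in>J. of_int (c j) * power_sum_part (range X) (\<alpha> j))"
    unfolding P_def by (simp add: ppoly_eval_sum ppoly_eval_single mfps_const_of_int)
  ultimately have "(THE P'. is_ppoly P' \<and>
      ppoly_eval P' = (\<Sum>j\<in>J. of_int (c j) * power_sum_part (range X) (\<alpha> j))) = P"
    by (intro the_equality) (auto intro: ppoly_eval_inject)
  then show ?thesis
    unfolding p_deriv_def
    by (simp add: P_def ppoly_deriv_sum ppoly_deriv_single ppoly_eval_sum ppoly_eval_single
        mfps_const_mult mfps_const_of_int mfps_const_of_nat mult_ac)
qed

text \<open>
  The multiplicity produced by differentiating a power is accounted for by the choice of the block
  that is removed.
\<close>

lemma power_sum_part_deriv_blocks:
  assumes "finite \<sigma>"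
  shows "of_nat (count (block_sizes \<sigma>) i) * power_sum_part Z (block_sizes \<sigma> - {#i#}) =
    (\<Sum>B | B \<in> \<sigma> \<and> card B = i. power_sum_part Z (block_sizes (\<sigma> - {B})))"
proof -
  have "block_sizes (\<sigma> - {B}) = block_sizes \<sigma> - {#i#}" if "B \<in> \<sigma>" "card B = i" for B
    using block_sizes_insert[of "\<sigma> - {B}" B] assms that by (simp add: insert_absorb)
  then have "(\<Sum>B | B \<in> \<sigma> \<and> card B = i. power_sum_part Z (block_sizes (\<sigma> - {B}))) =
      of_nat (card {B \<in> \<sigma>. card B = i}) * power_sum_part Z (block_sizes \<sigma> - {#i#})"
    by simp
  moreover have "count (block_sizes \<sigma>) i = card {B \<in> \<sigma>. card B = i}"
    using assms by (simp add: block_sizes_def count_image_mset' eq_commute[of i] Int_def)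
  ultimately show ?thesis by simp
qed

section \<open>Connected components\<close>

text \<open>
  Reachability in the underlying undirected graph, as a relation on the whole vertex type: unlike
  \<open>reachable\<close> it does not mention the vertex set, so it is visibly monotone in the arcs.
\<close>

definition linked :: "('a, 'b) pre_digraph \<Rightarrow> ('a \<times> 'a) set" where
  "linked G = (\<Union>e\<in>arcs G. {(tail G e, head G e), (head G e, tail G e)})\<^sup>*"

lemma linked_refl: "(u, u) \<in> linked G"
  by (simp add: linked_def)

lemma linked_trans: "(u, v) \<in> linked G \<Longrightarrow> (v, w) \<in> linked G \<Longrightarrow> (u, w) \<in> linked G"
  unfolding linked_def by (rule rtrancl_trans)

lemma linked_sym: "(u, v) \<in> linked G \<Longrightarrow> (v, u) \<in> linked G"
proof -
  have "sym (\<Union>e\<in>arcs G. {(tail G e, head G e), (head G e, tail G e)})"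
    by (auto intro!: symI)
  then show "(u, v) \<in> linked G \<Longrightarrow> (v, u) \<in> linked G"
    unfolding linked_def by (meson sym_rtrancl symD)
qed

lemma linked_arc: "e \<in> arcs G \<Longrightarrow> (tail G e, head G e) \<in> linked G"
  unfolding linked_def by (intro r_into_rtrancl) blast

lemma linked_induct [consumes 1, case_names refl tail head]:
  assumes "(u, v) \<in> linked G" "P u"
    and "\<And>e. e \<in> arcs G \<Longrightarrow> (u, tail G e) \<in> linked G \<Longrightarrow> P (tail G e) \<Longrightarrow> P (head G e)"
    and "\<And>e. e \<in> arcs G \<Longrightarrow> (u, head G e) \<in> linked G \<Longrightarrow> P (head G e) \<Longrightarrow> P (tail G e)"
  shows "P v"
  using assms(1) unfolding linked_def
proof (induction rule: rtrancl_induct)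
  case (step y z)
  from step.hyps(2) obtain e where "e \<in> arcs G" "(y, z) = (tail G e, head G e) \<or> (y, z) = (head G e, tail G e)"
    by blast
  with step.hyps(1) step.IH assms(3,4) show ?case unfolding linked_def by blast
qed (rule assms(2))

lemma linked_subgraph: "subgraph H G \<Longrightarrow> linked H \<subseteq> linked G"
  unfolding linked_def by (rule rtrancl_mono) (auto simp: subgraph_def compatible_def)

lemma connected_iff_linked:
  assumes "wf_digraph G"
  shows "connected G \<longleftrightarrow> verts G \<noteq> {} \<and> (\<forall>u\<in>verts G. \<forall>v\<in>verts G. (u, v) \<in> linked G)"
proof -
  interpret wf_digraph G by fact
  interpret S: pair_wf_digraph "mk_symmetric G" ..
  have "u \<rightarrow>\<^sup>*\<^bsub>with_proj (mk_symmetric G)\<^esub> v \<longleftrightarrow> (u, v) \<in> linked G" if "u \<in> verts G" for u v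
    using S.reachable_conv'[of u v] that
    by (simp add: linked_def parcs_mk_symmetric)
  then show ?thesis
    by (auto simp: connected_def strongly_connected_def)
qed

definition component_verts :: "('a, 'b) pre_digraph \<Rightarrow> 'a \<Rightarrow> 'a set" where
  "component_verts G v = {u. (v, u) \<in> linked G}"

lemma component_verts_subset:
  assumes "wf_digraph G" "v \<in> verts G"
  shows "component_verts G v \<subseteq> verts G"
proof
  interpret wf_digraph G by fact
  fix u assume "u \<in> component_verts G v"
  then have "(v, u) \<in> linked G" by (simp add: component_verts_def)
  then show "u \<in> verts G" by (induction rule: linked_induct) (use assms(2) in auto)
qed

lemma connected_component:
  assumes "wf_digraph G" "v \<in> verts G"
  shows "connected (G \<restriction> component_verts G v)"
proof -
  interpret wf_digraph G by fact
  let ?C = "G \<restriction> component_verts G v"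
  have *: "(v, u) \<in> linked ?C" if "(v, u) \<in> linked G" for u
    using that
  proof (induction rule: linked_induct)
    case refl
    show ?case by (rule linked_refl)
  next
    case (tail e)
    have "(v, head G e) \<in> linked G" using linked_trans[OF tail(2) linked_arc[OF tail(1)]] .
    then have "e \<in> arcs ?C" using tail(1,2) by (simp add: component_verts_def)
    then show ?case using linked_trans[OF tail(3)] linked_arc[of e ?C] by simp
  next
    case (head e)
    have "(v, tail G e) \<in> linked G"
      using linked_trans[OF head(2) linked_sym[OF linked_arc[OF head(1)]]] .
    then have "e \<in> arcs ?C" using head(1,2) by (simp add: component_verts_def)
    then show ?case using linked_trans[OF head(3)] linked_sym[OF linked_arc[of e ?C]] by simp
  qed
  have "(u, w) \<in> linked ?C" if "u \<in> component_verts G v" "w \<in> component_verts G v" for u w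
    using *[of u] *[of w] that linked_sym linked_trans by (metis component_verts_def mem_Collect_eq)
  moreover have "v \<in> component_verts G v" by (simp add: component_verts_def linked_refl)
  ultimately show ?thesis
    using wellformed_induce_subgraph by (subst connected_iff_linked) auto
qed

text \<open>
  A connected subgraph through \<open>v\<close> lies inside the graph induced by the class of \<open>v\<close>, and that
  graph is itself connected; so it is the only maximal connected subgraph through \<open>v\<close>.
\<close>

lemma components_conv:
  assumes "wf_digraph G"
  shows "components G = (\<lambda>v. G \<restriction> component_verts G v) ` verts G"
proof -
  interpret wf_digraph G by fact
  have sub: "subgraph H (G \<restriction> component_verts G v)"
    if "subgraph H G" "connected H" "v \<in> verts H" for H v
  proof -
    have wf: "wf_digraph H" using that(1) by blast
    have "verts H \<subseteq> component_verts G v"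
    proof
      fix u assume "u \<in> verts H"
      then have "(v, u) \<in> linked H" using that connected_iff_linked[OF wf] by blast
      then show "u \<in> component_verts G v"
        using linked_subgraph[OF that(1)] by (auto simp: component_verts_def)
    qed
    moreover have "tail G e \<in> verts H \<and> head G e \<in> verts H \<and> e \<in> arcs G" if "e \<in> arcs H" for e
      using wf_digraph.wellformed[OF wf that] \<open>subgraph H G\<close> that
      by (auto simp: subgraph_def compatible_def)
    ultimately show ?thesis
      using that(1) wf wellformed_induce_subgraph by (auto simp: subgraph_def compatible_def)
  qed
  have csub: "subgraph (G \<restriction> component_verts G v) G" if "v \<in> verts G" for v
    using induced_induce[OF component_verts_subset[OF assms that]] by (rule induced_imp_subgraph)
  have self: "v \<in> component_verts G v" for v by (simp add: component_verts_def linked_refl)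
  show ?thesis
  proof (intro equalityI subsetI)
    fix C assume "C \<in> components G"
    then have C: "subgraph C G" "connected C"
      and max: "\<And>H. H \<noteq> C \<Longrightarrow> subgraph C H \<Longrightarrow> subgraph H G \<Longrightarrow> connected H \<Longrightarrow> False"
      unfolding components_def max_subgraph_def by blast+
    have "wf_digraph C" using C(1) by blast
    with C(2) obtain v where v: "v \<in> verts C" using connected_iff_linked by blast
    then have "v \<in> verts G" using C(1) by blast
    then have "C = G \<restriction> component_verts G v"
      using max[OF _ sub[OF C v] csub connected_component[OF assms]] by metis
    then show "C \<in> (\<lambda>v. G \<restriction> component_verts G v) ` verts G" using \<open>v \<in> verts G\<close> by blast
  next
    fix C assume "C \<in> (\<lambda>v. G \<restriction> component_verts G v) ` verts G"
    then obtain v where v: "v \<in> verts G" and C: "C = G \<restriction> component_verts G v" by blast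
    have "H = C" if H: "subgraph C H" "subgraph H G" "connected H" for H
    proof -
      have "v \<in> verts H" using H(1) self C by (auto simp: subgraph_def)
      then have "subgraph H C" using sub H C by blast
      with H(1) show "H = C"
        by (auto simp: subgraph_def compatible_def intro!: pre_digraph.equality)
    qed
    then show "C \<in> components G"
      unfolding components_def max_subgraph_def
      using csub[OF v] connected_component[OF assms v] C by blast
  qed
qed

lemma partition_on_components:
  assumes "wf_digraph G"
  shows "partition_on (verts G) (verts ` components G)"
proof -
  have eq: "verts ` components G = component_verts G ` verts G"
    unfolding components_conv[OF assms] by (simp add: image_image)
  have self: "v \<in> component_verts G v" for v by (simp add: component_verts_def linked_refl)
  have same: "component_verts G u = component_verts G v" if "(u, v) \<in> linked G" for u v
    unfolding component_verts_def using that linked_trans[of _ _ G] linked_sym[of _ _ G] by blast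
  show ?thesis unfolding eq
  proof (rule partition_onI)
    show "\<Union> (component_verts G ` verts G) = verts G"
      using self component_verts_subset[OF assms] by blast
    show "{} \<notin> component_verts G ` verts G" using self by blast
    fix B C assume "B \<in> component_verts G ` verts G" "C \<in> component_verts G ` verts G" "B \<noteq> C"
    then obtain u v where uv: "B = component_verts G u" "C = component_verts G v"
      "component_verts G u \<noteq> component_verts G v" by blast
    show "disjnt B C"
    proof (rule ccontr)
      assume "\<not> disjnt B C"
      then obtain w where "(u, w) \<in> linked G" "(v, w) \<in> linked G"
        unfolding disjnt_def uv component_verts_def by blast
      then show False using same[of u w] same[of v w] uv(3) by simp
    qed
  qed
qed

lemma component_of_arc:
  assumes "wf_digraph G" "e \<in> arcs G"
  obtains B where "B \<in> verts ` components G" "tail G e \<in> B" "head G e \<in> B"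
proof -
  interpret wf_digraph G by fact
  show ?thesis
  proof (rule that[of "component_verts G (tail G e)"])
    show "component_verts G (tail G e) \<in> verts ` components G"
      unfolding components_conv[OF assms(1)] using assms(2) by (simp add: image_image)
    show "tail G e \<in> component_verts G (tail G e)" "head G e \<in> component_verts G (tail G e)"
      using linked_refl linked_arc[OF assms(2)] by (simp_all add: component_verts_def)
  qed
qed

text \<open>
  If no arc crosses the boundary of \<open>W\<close>, an undirected walk that starts in \<open>W\<close> never leaves it.
\<close>

lemma component_induced_eq:
  assumes "wf_digraph G" "\<And>e. e \<in> arcs G \<Longrightarrow> tail G e \<in> W \<longleftrightarrow> head G e \<in> W" "v \<in> W"
  shows "(G \<restriction> W) \<restriction> component_verts (G \<restriction> W) v = G \<restriction> component_verts G v"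
proof -
  have *: "u \<in> W \<and> (v, u) \<in> linked (G \<restriction> W)" if "(v, u) \<in> linked G" for u
    using that
  proof (induction rule: linked_induct)
    case refl
    show ?case by (simp add: assms(3) linked_refl)
  next
    case (tail e)
    then have "e \<in> arcs (G \<restriction> W)" using assms(2) by simp
    then show ?case
      using linked_trans[of v "tail G e" "G \<restriction> W"] linked_arc[of e "G \<restriction> W"] tail assms(2) by simp
  next
    case (head e)
    then have "e \<in> arcs (G \<restriction> W)" using assms(2) by simp
    then show ?case
      using linked_trans[of v "head G e" "G \<restriction> W"] linked_sym[OF linked_arc[of e "G \<restriction> W"]] head assms(2)
      by simp
  qed
  moreover have "linked (G \<restriction> W) \<subseteq> linked G"
    unfolding linked_def by (rule rtrancl_mono) auto
  ultimately have eq: "component_verts (G \<restriction> W) v = component_verts G v"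
    and sub: "component_verts G v \<subseteq> W"
    unfolding component_verts_def by blast+
  show ?thesis unfolding eq using sub by (auto simp: induce_subgraph_def)
qed

lemma components_split:
  assumes "wf_digraph G" "W \<subseteq> verts G" "\<And>e. e \<in> arcs G \<Longrightarrow> tail G e \<in> W \<longleftrightarrow> head G e \<in> W"
  shows "components G = components (G \<restriction> W) \<union> components (G \<restriction> (verts G - W))"
proof -
  interpret wf_digraph G by fact
  let ?W' = "verts G - W"
  have cross: "tail G e \<in> ?W' \<longleftrightarrow> head G e \<in> ?W'" if "e \<in> arcs G" for e
    using assms(3)[OF that] that by simp
  have "components (G \<restriction> W) = (\<lambda>v. G \<restriction> component_verts G v) ` W"
    unfolding components_conv[OF wellformed_induce_subgraph] induce_subgraph_verts
    by (intro image_cong refl component_induced_eq[OF assms(1,3)])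
  moreover have "components (G \<restriction> ?W') = (\<lambda>v. G \<restriction> component_verts G v) ` ?W'"
    unfolding components_conv[OF wellformed_induce_subgraph] induce_subgraph_verts
    by (intro image_cong refl component_induced_eq[OF assms(1) cross])
  moreover have "verts G = W \<union> ?W'" using assms(2) by blast
  ultimately show ?thesis
    unfolding components_conv[OF assms(1)] by (metis image_Un)
qed

section \<open>Path covers of acyclic digraphs\<close>

lemma spanning_part_simps [simp]:
  "verts (spanning_part D S) = verts D" "arcs (spanning_part D S) = S"
  "tail (spanning_part D S) = tail D" "head (spanning_part D S) = head D"
  by (simp_all add: spanning_part_def)

lemma subgraph_spanning_part:
  assumes "wf_digraph D" "S \<subseteq> arcs D"
  shows "subgraph (spanning_part D S) D"
proof -
  interpret wf_digraph D by fact
  have "wf_digraph (spanning_part D S)" by unfold_locales (use assms(2) in auto)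
  then show ?thesis using assms by (auto simp: subgraph_def compatible_def)
qed

lemma acyclic_digraph_subgraph:
  assumes "wf_digraph D" "acyclic_digraph D" "subgraph H D"
  shows "acyclic_digraph H"
  using assms wf_digraph.subgraph_cycle unfolding acyclic_digraph_def by blast

lemma component_not_directed_cycle:
  assumes "wf_digraph D" "acyclic_digraph D" "S \<subseteq> arcs D" "C \<in> components (spanning_part D S)"
  shows "\<not> is_directed_cycle C"
proof -
  have "subgraph C (spanning_part D S)"
    using assms(4) by (simp add: components_def pre_digraph.max_subgraph_def)
  then have "subgraph C D" using subgraph_spanning_part[OF assms(1,3)] by (rule subgraph_trans)
  then show ?thesis
    using acyclic_digraph_subgraph[OF assms(1,2)] unfolding is_directed_cycle_def acyclic_digraph_def by blast
qed

lemma path_cover_iff: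
  assumes "wf_digraph D" "acyclic_digraph D"
  shows "path_cover D S \<longleftrightarrow> S \<subseteq> arcs D \<and> (\<forall>C\<in>components (spanning_part D S). is_directed_path C)"
  using component_not_directed_cycle[OF assms]
  unfolding path_cover_def path_cycle_cover_def cycle_blocks_def by blast

lemma path_cycle_cover_iff_path_cover:
  assumes "wf_digraph D" "acyclic_digraph D"
  shows "path_cycle_cover D S \<longleftrightarrow> path_cover D S"
  using component_not_directed_cycle[OF assms]
  unfolding path_cover_def path_cycle_cover_def cycle_blocks_def by blast

lemma path_blocks_path_cover:
  assumes "wf_digraph D" "acyclic_digraph D" "path_cover D S"
  shows "path_blocks D S = verts ` components (spanning_part D S)"
  using assms(3) unfolding path_blocks_def path_cover_iff[OF assms(1,2)] by auto

lemma partition_on_path_blocks: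
  assumes "wf_digraph D" "acyclic_digraph D" "path_cover D S"
  shows "partition_on (verts D) (path_blocks D S)"
proof -
  have "wf_digraph (spanning_part D S)"
    using subgraph_spanning_part[OF assms(1)] assms by (auto simp: path_cover_iff)
  from partition_on_components[OF this] show ?thesis
    by (simp add: path_blocks_path_cover[OF assms])
qed

text \<open>
  Being a path cover is a condition on the components of the spanning subgraph, and no component
  extends across \<open>W\<close> when the chosen arcs do not.
\<close>

lemma path_cover_split:
  assumes "wf_digraph D" "acyclic_digraph D" "W \<subseteq> verts D"
    and "S1 \<subseteq> arcs (D \<restriction> W)" "S2 \<subseteq> arcs (D \<restriction> (verts D - W))"
  shows "path_cover D (S1 \<union> S2) \<longleftrightarrow> path_cover (D \<restriction> W) S1 \<and> path_cover (D \<restriction> (verts D - W)) S2"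
    and "path_cover D (S1 \<union> S2) \<Longrightarrow>
      path_blocks D (S1 \<union> S2) = path_blocks (D \<restriction> W) S1 \<union> path_blocks (D \<restriction> (verts D - W)) S2"
proof -
  interpret wf_digraph D by fact
  let ?W' = "verts D - W"
  let ?G = "spanning_part D (S1 \<union> S2)"
  have S: "S1 \<union> S2 \<subseteq> arcs D" using assms(4,5) by auto
  have wfG: "wf_digraph ?G" using subgraph_spanning_part[OF assms(1) S] by blast
  have "?G \<restriction> W = spanning_part (D \<restriction> W) S1" "?G \<restriction> ?W' = spanning_part (D \<restriction> ?W') S2"
    using assms(4,5) by (auto simp: induce_subgraph_def spanning_part_def)
  moreover have "tail ?G e \<in> W \<longleftrightarrow> head ?G e \<in> W" if "e \<in> arcs ?G" for e
    using that assms(4,5) by auto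
  ultimately have comp: "components ?G =
      components (spanning_part (D \<restriction> W) S1) \<union> components (spanning_part (D \<restriction> ?W') S2)"
    using components_split[OF wfG, of W] assms(3) by simp
  have sub: "subgraph (D \<restriction> W) D" "subgraph (D \<restriction> ?W') D"
    using assms(3) by (auto intro: induced_imp_subgraph induced_induce)
  note wf = wellformed_induce_subgraph
  note acyc = acyclic_digraph_subgraph[OF assms(1,2) sub(1)] acyclic_digraph_subgraph[OF assms(1,2) sub(2)]
  show iff: "path_cover D (S1 \<union> S2) \<longleftrightarrow> path_cover (D \<restriction> W) S1 \<and> path_cover (D \<restriction> ?W') S2"
    unfolding path_cover_iff[OF assms(1,2)] path_cover_iff[OF wf acyc(1)] path_cover_iff[OF wf acyc(2)] comp
    using S assms(4,5) by blast
  assume cov: "path_cover D (S1 \<union> S2)"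
  show "path_blocks D (S1 \<union> S2) = path_blocks (D \<restriction> W) S1 \<union> path_blocks (D \<restriction> ?W') S2"
    using cov iff
    by (simp add: path_blocks_path_cover[OF assms(1,2)] path_blocks_path_cover[OF wf acyc(1)]
        path_blocks_path_cover[OF wf acyc(2)] comp image_Un)
qed

text \<open>
  The two ends of an arc lie on the same path, hence in the same block of any coarser partition.
\<close>

lemma path_cover_arc_within_block:
  assumes "wf_digraph D" "acyclic_digraph D" "path_cover D S"
    and "refines (verts D) (path_blocks D S) \<sigma>" "B \<in> \<sigma>" "e \<in> S"
  shows "tail D e \<in> B \<longleftrightarrow> head D e \<in> B"
proof -
  have "wf_digraph (spanning_part D S)"
    using subgraph_spanning_part[OF assms(1)] assms by (auto simp: path_cover_iff)
  then obtain C where "C \<in> path_blocks D S" "tail D e \<in> C" "head D e \<in> C"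
    using component_of_arc[of "spanning_part D S" e] assms(6)
    unfolding path_blocks_path_cover[OF assms(1-3)] by auto
  then obtain B' where B': "B' \<in> \<sigma>" "tail D e \<in> B'" "head D e \<in> B'"
    using refines_block[OF assms(4)] by blast
  have "B = B'" if "v \<in> B" "v \<in> B'" for v
    using disjointD[OF partition_onD2[OF refines_partition(2)[OF assms(4)]] assms(5) B'(1)] that by blast
  with B' show ?thesis by blast
qed

lemma finite_path_covers:
  assumes "fin_digraph D"
  shows "finite {S. path_cover D S}"
proof (rule finite_subset)
  show "{S. path_cover D S} \<subseteq> Pow (arcs D)" by (auto simp: path_cover_def path_cycle_cover_def)
  show "finite (Pow (arcs D))" using fin_digraph.finite_arcs[OF assms] by simp
qed

section \<open>The derivative of the path-cycle symmetric function\<close>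

text \<open>
  The index set of the expansion of \<open>\<Xi>\<^sub>D\<close> in power sums: \<open>(S, \<sigma>)\<close> contributes
  \<open>\<mu>(\<pi>(S), \<sigma>) p\<^sub>\<sigma>\<close>.
\<close>

definition coarsened_covers :: "('a, 'b) pre_digraph \<Rightarrow> ('b set \<times> 'a set set) set" where
  "coarsened_covers D = (SIGMA S:{S. path_cover D S}. {\<sigma>. refines (verts D) (path_blocks D S) \<sigma>})"

definition cover_moebius :: "('a, 'b) pre_digraph \<Rightarrow> 'b set \<times> 'a set set \<Rightarrow> int" where
  "cover_moebius D = (\<lambda>(S, \<sigma>). partition_moebius (verts D) (path_blocks D S) \<sigma>)"

lemma finite_coarsened_covers: "fin_digraph D \<Longrightarrow> finite (coarsened_covers D)"
  unfolding coarsened_covers_def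
  by (intro finite_SigmaI finite_path_covers finite_refines_left fin_digraph.finite_verts) auto

lemma path_cycle_symfun_as_power_sums:
  assumes "fin_digraph D" "acyclic_digraph D"
  shows "path_cycle_symfun D =
    (\<Sum>j\<in>coarsened_covers D. of_int (cover_moebius D j) * power_sum_part (range X) (block_sizes (snd j)))"
proof -
  interpret fin_digraph D by fact
  note wf = wf_digraph
  have "path_cycle_symfun D = (\<Sum>S | path_cover D S. aug_monomial_sym (range X) (block_sizes (path_blocks D S)))"
    unfolding path_cycle_symfun_def path_cycle_cover_iff_path_cover[OF wf assms(2)]
    by (rule sum.cong) (auto simp: path_cover_def)
  also have "\<dots> = (\<Sum>S | path_cover D S. \<Sum>\<sigma> | refines (verts D) (path_blocks D S) \<sigma>.
      of_int (cover_moebius D (S, \<sigma>)) * power_sum_part (range X) (block_sizes (snd (S, \<sigma>))))"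
    using aug_monomial_sym_as_power_sums[OF finite_verts partition_on_path_blocks[OF wf assms(2)]]
    by (intro sum.cong refl) (simp add: cover_moebius_def)
  also have "\<dots> = (\<Sum>j\<in>coarsened_covers D.
      of_int (cover_moebius D j) * power_sum_part (range X) (block_sizes (snd j)))"
    unfolding coarsened_covers_def
    by (subst sum.Sigma) (auto simp: finite_path_covers[OF assms(1)] finite_refines_left case_prod_beta)
  finally show ?thesis .
qed

lemma zero_notin_block_sizes:
  assumes "finite V" "partition_on V \<sigma>"
  shows "0 \<notin># block_sizes \<sigma>"
proof -
  have "finite \<sigma>" using assms by (rule finite_elements)
  moreover have "card B \<noteq> 0" if "B \<in> \<sigma>" for B
  proof -
    have "B \<subseteq> V" "B \<noteq> {}" using that assms(2) by (auto simp: partition_on_def)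
    then show ?thesis using finite_subset[OF _ assms(1)] by (simp add: card_eq_0_iff)
  qed
  ultimately show ?thesis by (metis block_sizes_def finite_set_mset_mset_set imageE set_image_mset)
qed

text \<open>
  The heart of the argument: cutting along a block \<open>B\<close> of \<open>\<sigma>\<close> loses no arc of the cover, and
  conversely covers of the two pieces combine freely. The set \<open>B\<close> is nonempty because \<open>{B}\<close>
  has to be a partition of it.
\<close>

lemma coarsened_covers_with_block:
  assumes "wf_digraph D" "acyclic_digraph D" "finite (verts D)" "B \<subseteq> verts D" "B \<noteq> {}"
  defines "D1 \<equiv> D \<restriction> B" and "D2 \<equiv> D \<restriction> (verts D - B)"
  shows "bij_betw (\<lambda>(S1, S2, \<sigma>). (S1 \<union> S2, insert B \<sigma>))
      ({S. path_cover D1 S} \<times> coarsened_covers D2) {j \<in> coarsened_covers D. B \<in> snd j}"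
    and "S1 \<in> {S. path_cover D1 S} \<Longrightarrow> j \<in> coarsened_covers D2 \<Longrightarrow>
      cover_moebius D (S1 \<union> fst j, insert B (snd j)) =
      partition_moebius B (path_blocks D1 S1) {B} * cover_moebius D2 j"
proof -
  interpret wf_digraph D by fact
  let ?V2 = "verts D - B"
  have sub: "subgraph D1 D" "subgraph D2 D"
    using assms(4) unfolding D1_def D2_def by (auto intro: induced_imp_subgraph induced_induce)
  have wf: "wf_digraph D1" "wf_digraph D2" using sub by blast+
  note acyc = acyclic_digraph_subgraph[OF assms(1,2) sub(1)] acyclic_digraph_subgraph[OF assms(1,2) sub(2)]
  have verts: "verts D1 = B" "verts D2 = ?V2" by (simp_all add: D1_def D2_def)
  have arcs: "S1 \<subseteq> arcs D1" "S2 \<subseteq> arcs D2" if "path_cover D1 S1" "path_cover D2 S2" for S1 S2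
    using that path_cover_iff[OF wf(1) acyc(1)] path_cover_iff[OF wf(2) acyc(2)] by blast+
  have V: "B \<union> ?V2 = verts D" "B \<inter> ?V2 = {}" using assms(4) by blast+
  have ref1: "refines B (path_blocks D1 S1) {B}" if "path_cover D1 S1" for S1
    using partition_on_path_blocks[OF wf(1) acyc(1) that] partition_on_space[OF assms(5)]
    unfolding verts refines_def by (auto simp: partition_on_def)
  have cover: "path_cover D (S1 \<union> S2)"
    and blocks: "path_blocks D (S1 \<union> S2) = path_blocks D1 S1 \<union> path_blocks D2 S2"
    if "path_cover D1 S1" "path_cover D2 S2" for S1 S2
    using path_cover_split[OF assms(1,2,4) arcs[OF that, unfolded D1_def D2_def]] that
    unfolding D1_def D2_def by blast+
  have ref: "refines (verts D) (path_blocks D (S1 \<union> S2)) (insert B \<sigma>)"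
    if "path_cover D1 S1" "(S2, \<sigma>) \<in> coarsened_covers D2" for S1 S2 \<sigma>
    using refines_Un[OF ref1[OF that(1)] _ V(2), of "path_blocks D2 S2" \<sigma>] that blocks[of S1 S2]
    unfolding V(1) by (auto simp: coarsened_covers_def verts)
  show "cover_moebius D (S1 \<union> fst j, insert B (snd j)) =
      partition_moebius B (path_blocks D1 S1) {B} * cover_moebius D2 j"
    if "S1 \<in> {S. path_cover D1 S}" "j \<in> coarsened_covers D2"
  proof -
    obtain S2 \<sigma> where j: "j = (S2, \<sigma>)" by (cases j)
    have S1: "path_cover D1 S1" and S2: "path_cover D2 S2" "refines ?V2 (path_blocks D2 S2) \<sigma>"
      using that by (auto simp: j coarsened_covers_def verts)
    have "finite B" "finite ?V2" using assms(3,4) finite_subset by auto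
    from partition_moebius_Un[OF this V(2) ref1[OF S1] S2(2)] show ?thesis
      unfolding V(1) by (simp add: cover_moebius_def j verts blocks[OF S1 S2(1)])
  qed
  have notin: "B \<notin> \<sigma>" if "(S2, \<sigma>) \<in> coarsened_covers D2" for S2 \<sigma>
  proof
    assume "B \<in> \<sigma>"
    moreover have "partition_on ?V2 \<sigma>"
      using that refines_partition(2) by (auto simp: coarsened_covers_def verts)
    ultimately have "B \<subseteq> ?V2" by (auto simp: partition_on_def)
    then show False using assms(5) by blast
  qed
  let ?g = "\<lambda>(S, \<sigma>). (S \<inter> arcs D1, S \<inter> arcs D2, \<sigma> - {B})"
  have arcs_disj: "arcs D1 \<inter> arcs D2 = {}" by (auto simp: D1_def D2_def)
  show "bij_betw (\<lambda>(S1, S2, \<sigma>). (S1 \<union> S2, insert B \<sigma>))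
      ({S. path_cover D1 S} \<times> coarsened_covers D2) {j \<in> coarsened_covers D. B \<in> snd j}"
    (is "bij_betw ?f ?P ?Q")
  proof (rule bij_betw_byWitness[where f' = ?g])
    show "\<forall>p\<in>?P. ?g (?f p) = p"
    proof
      fix p assume "p \<in> ?P"
      then obtain S1 S2 \<sigma> where p: "p = (S1, S2, \<sigma>)" "path_cover D1 S1" "(S2, \<sigma>) \<in> coarsened_covers D2"
        by (metis SigmaE mem_Collect_eq prod.collapse)
      have "path_cover D2 S2" using p(3) by (auto simp: coarsened_covers_def)
      from arcs[OF p(2) this] show "?g (?f p) = p"
        using arcs_disj notin[OF p(3)] p(1) by auto
    qed
    show "?f ` ?P \<subseteq> ?Q"
    proof (rule image_subsetI)
      fix p assume "p \<in> ?P"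
      then obtain S1 S2 \<sigma> where p: "p = (S1, S2, \<sigma>)" "path_cover D1 S1" "(S2, \<sigma>) \<in> coarsened_covers D2"
        by (metis SigmaE mem_Collect_eq prod.collapse)
      have "path_cover D2 S2" using p(3) by (auto simp: coarsened_covers_def)
      then show "?f p \<in> ?Q"
        using cover[OF p(2)] ref[OF p(2,3)] p(1) by (simp add: coarsened_covers_def)
    qed
    have split: "S \<inter> arcs D1 \<union> S \<inter> arcs D2 = S"
      if "path_cover D S" "refines (verts D) (path_blocks D S) \<sigma>" "B \<in> \<sigma>" for S \<sigma>
    proof -
      have "e \<in> arcs D1 \<or> e \<in> arcs D2" if e: "e \<in> S" for e
      proof -
        have "e \<in> arcs D" using e \<open>path_cover D S\<close> path_cover_iff[OF assms(1,2)] by blast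
        then show ?thesis
          using path_cover_arc_within_block[OF assms(1,2) \<open>path_cover D S\<close>
              \<open>refines (verts D) (path_blocks D S) \<sigma>\<close> \<open>B \<in> \<sigma>\<close> e]
          by (auto simp: D1_def D2_def)
      qed
      then show ?thesis by blast
    qed
    show "\<forall>q\<in>?Q. ?f (?g q) = q"
    proof
      fix q assume "q \<in> ?Q"
      then obtain S \<sigma> where q: "q = (S, \<sigma>)" "path_cover D S"
        "refines (verts D) (path_blocks D S) \<sigma>" "B \<in> \<sigma>" by (auto simp: coarsened_covers_def)
      show "?f (?g q) = q" using split[OF q(2-4)] q(1,4) by (simp add: insert_absorb)
    qed
    show "?g ` ?Q \<subseteq> ?P"
    proof (rule image_subsetI)
      fix q assume "q \<in> ?Q"
      then obtain S \<sigma> where q: "q = (S, \<sigma>)" "path_cover D S"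
        "refines (verts D) (path_blocks D S) \<sigma>" "B \<in> \<sigma>" by (auto simp: coarsened_covers_def)
      let ?S1 = "S \<inter> arcs D1" and ?S2 = "S \<inter> arcs D2"
      have S12: "?S1 \<subseteq> arcs (D \<restriction> B)" "?S2 \<subseteq> arcs (D \<restriction> ?V2)" by (auto simp: D1_def D2_def)
      have S: "?S1 \<union> ?S2 = S" by (rule split[OF q(2-4)])
      have c: "path_cover D1 ?S1" "path_cover D2 ?S2"
        using path_cover_split(1)[OF assms(1,2,4) S12] q(2) unfolding S D1_def[symmetric] D2_def[symmetric]
        by blast+
      have b: "path_blocks D S = path_blocks D1 ?S1 \<union> path_blocks D2 ?S2"
        using blocks[OF c] S by simp
      have part2: "partition_on ?V2 (path_blocks D2 ?S2)"
        using partition_on_path_blocks[OF wf(2) acyc(2) c(2)] verts by simp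
      have "partition_on ?V2 (\<sigma> - {B})"
      proof -
        have ins: "insert B (\<sigma> - {B}) = \<sigma>" using q(4) by blast
        then have \<sigma>: "partition_on (verts D) (insert B (\<sigma> - {B}))"
          using refines_partition(2)[OF q(3)] by simp
        have notB: "B \<notin> \<sigma> - {B}" by simp
        note parts = partition_on_insertD[OF assms(3) \<sigma> notB]
        have "verts D = B \<union> \<Union>(\<sigma> - {B})" using partition_onD1[OF \<sigma>] by (simp only: Union_insert)
        then have "?V2 = \<Union>(\<sigma> - {B})" using parts(1) by blast
        then show ?thesis using parts(2) by simp
      qed
      moreover have "\<exists>C\<in>\<sigma> - {B}. A \<subseteq> C" if A: "A \<in> path_blocks D2 ?S2" for A
      proof -
        have "A \<subseteq> ?V2" "A \<noteq> {}" using A part2 by (auto simp: partition_on_def)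
        then have "\<not> A \<subseteq> B" by blast
        moreover have "A \<in> path_blocks D S" using A b by simp
        ultimately show ?thesis using refines_block[OF q(3), of A] by blast
      qed
      ultimately have "refines ?V2 (path_blocks D2 ?S2) (\<sigma> - {B})"
        using part2 by (simp add: refines_def)
      then show "?g q \<in> ?P" using c q(1) by (simp add: coarsened_covers_def verts)
    qed
  qed
qed

theorem proposition8:
  fixes D :: "('a, 'b) pre_digraph" and i :: nat
  assumes "fin_digraph D" and "nomulti_digraph D"
    and "acyclic_digraph D"
    and "i \<ge> 1"
  shows "p_deriv i (path_cycle_symfun D) =
    (\<Sum>H | induced_subgraph H D \<and> card (verts H) = i.
       of_int (\<Sum>S | path_cover H S. partition_moebius (verts H) (path_blocks H S) {verts H}) *
       path_cycle_symfun (delete_verts D (verts H)))"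
proof -
  interpret fin_digraph D by fact
  note wf = wf_digraph
  let ?V = "verts D"
  let ?p = "\<lambda>\<sigma>. power_sum_part (range X) (block_sizes \<sigma>)"
  let ?J = "coarsened_covers D"
  let ?Bs = "{B. B \<subseteq> ?V \<and> card B = i}"
  let ?term = "\<lambda>H. of_int (\<Sum>S | path_cover H S. partition_moebius (verts H) (path_blocks H S) {verts H}) *
       path_cycle_symfun (delete_verts D (verts H))"
  have part: "partition_on ?V (snd j)" if "j \<in> ?J" for j
    using that refines_partition(2) by (auto simp: coarsened_covers_def)
  have finJ: "finite ?J" by (rule finite_coarsened_covers[OF assms(1)])
  have "p_deriv i (path_cycle_symfun D) = (\<Sum>j\<in>?J. of_int (cover_moebius D j) *
      (of_nat (count (block_sizes (snd j)) i) * power_sum_part (range X) (block_sizes (snd j) - {#i#})))"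
    unfolding path_cycle_symfun_as_power_sums[OF assms(1,3)]
    by (rule p_deriv_power_sums) (rule zero_notin_block_sizes[OF finite_verts part])
  also have "\<dots> = (\<Sum>j\<in>?J. \<Sum>B\<in>{B\<in>?Bs. B \<in> snd j}. of_int (cover_moebius D j) * ?p (snd j - {B}))"
  proof (rule sum.cong[OF refl])
    fix j assume j: "j \<in> ?J"
    \<comment> \<open>Every block of a partition of the vertices is one of the candidate sets \<open>B\<close>.\<close>
    have "{B\<in>?Bs. B \<in> snd j} = {B. B \<in> snd j \<and> card B = i}"
      using part[OF j] by (auto simp: partition_on_def)
    then show "of_int (cover_moebius D j) * (of_nat (count (block_sizes (snd j)) i) *
        power_sum_part (range X) (block_sizes (snd j) - {#i#})) =
      (\<Sum>B\<in>{B\<in>?Bs. B \<in> snd j}. of_int (cover_moebius D j) * ?p (snd j - {B}))"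
      using power_sum_part_deriv_blocks[OF finite_elements[OF finite_verts part[OF j]]]
      by (simp add: sum_distrib_left)
  qed
  also have "\<dots> = (\<Sum>B\<in>?Bs. \<Sum>j\<in>{j\<in>?J. B \<in> snd j}. of_int (cover_moebius D j) * ?p (snd j - {B}))"
    by (rule sum.swap_restrict[OF finJ]) simp
  also have "\<dots> = (\<Sum>B\<in>?Bs. ?term (D \<restriction> B))"
  proof (rule sum.cong[OF refl])
    fix B assume B: "B \<in> ?Bs"
    let ?D1 = "D \<restriction> B" and ?D2 = "D \<restriction> (?V - B)"
    have B': "B \<subseteq> ?V" "B \<noteq> {}" using B assms(4) by auto
    have sub2: "subgraph ?D2 D" by (auto intro: induced_imp_subgraph)
    have fin2: "fin_digraph ?D2" by (rule fin_digraph_subgraph[OF sub2])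
    have acyc2: "acyclic_digraph ?D2" by (rule acyclic_digraph_subgraph[OF wf assms(3) sub2])
    note bij = coarsened_covers_with_block[OF wf assms(3) finite_verts B']
    let ?P = "{S. path_cover ?D1 S} \<times> coarsened_covers ?D2"
    have "(\<Sum>j\<in>{j\<in>?J. B \<in> snd j}. of_int (cover_moebius D j) * ?p (snd j - {B})) =
        (\<Sum>(S1, S2, \<sigma>)\<in>?P. of_int (cover_moebius D (S1 \<union> S2, insert B \<sigma>)) * ?p (insert B \<sigma> - {B}))"
      by (subst sum.reindex_bij_betw[OF bij(1), symmetric]) (simp add: case_prod_beta)
    also have "\<dots> = (\<Sum>(S1, j)\<in>?P. of_int (partition_moebius B (path_blocks ?D1 S1) {B}) *
        (of_int (cover_moebius ?D2 j) * ?p (snd j)))"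
    proof (rule sum.cong[OF refl], clarify)
      fix S1 S2 \<sigma> assume *: "path_cover ?D1 S1" "(S2, \<sigma>) \<in> coarsened_covers ?D2"
      have "partition_on (?V - B) \<sigma>"
        using *(2) refines_partition(2) by (fastforce simp: coarsened_covers_def)
      then have "C \<subseteq> ?V - B" if "C \<in> \<sigma>" for C using that by (auto simp: partition_on_def)
      then have "B \<notin> \<sigma>" using B'(2) by blast
      then show "of_int (cover_moebius D (S1 \<union> S2, insert B \<sigma>)) * ?p (insert B \<sigma> - {B}) =
          of_int (partition_moebius B (path_blocks ?D1 S1) {B}) *
          (of_int (cover_moebius ?D2 (S2, \<sigma>)) * ?p (snd (S2, \<sigma>)))"
        using bij(2)[OF _ *(2), of S1] *(1) by (simp add: mult.assoc)
    qed
    also have "\<dots> = (\<Sum>S1 | path_cover ?D1 S1. of_int (partition_moebius B (path_blocks ?D1 S1) {B})) *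
        (\<Sum>j\<in>coarsened_covers ?D2. of_int (cover_moebius ?D2 j) * ?p (snd j))"
      by (simp only: sum.cartesian_product sum_product)
    also have "\<dots> = ?term ?D1"
      by (simp add: path_cycle_symfun_as_power_sums[OF fin2 acyc2] delete_verts_def)
    finally show "(\<Sum>j\<in>{j\<in>?J. B \<in> snd j}. of_int (cover_moebius D j) * ?p (snd j - {B})) = ?term ?D1" .
  qed
  also have "\<dots> = (\<Sum>H | induced_subgraph H D \<and> card (verts H) = i. ?term H)"
  proof (rule sum.reindex_bij_witness[where i = verts and j = "\<lambda>B. D \<restriction> B"])
    fix H assume H: "H \<in> {H. induced_subgraph H D \<and> card (verts H) = i}"
    then have "verts H \<subseteq> ?V" by (auto simp: induced_subgraph_def subgraph_def)
    then show "verts H \<in> ?Bs" using H by simp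
    show "D \<restriction> verts H = H"
      using induced_eq_verts_imp_eq[OF induced_induce[OF \<open>verts H \<subseteq> ?V\<close>], of H] H by simp
  qed auto
  finally show ?thesis .
qed

end
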